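(* Let $X$ be a Peano continuum without cut points which does not admit an essential map to the circle $S^1$. Suppose a group $G$ acts on $X$ by homeomorphisms and $\mathcal{A}$ is a $G$-invariant collection of connected closed subsets of $X$ such that: (i) $\mathcal{A}$ is null: for every $\epsilon>0$ the set $\{A\in\mathcal{A} : \operatorname{diam}(A)>\epsilon\}$ is finite; (ii) $\mathcal{A}$ is fine: for any $x,y\in X$ there is a finite $\mathcal{B}\subset\mathcal{A}$ such that $\bigcup\mathcal{B}$ separates $x$ from $y$; (iii) for each $A\in\mathcal{A}$, the stabilizer $\mathrm{Stab}(A)=\{g\in G: g(A)=A\}$ acts as a convergence group on $A$. Then $G$ acts as a convergence group on $X$.
   Context: A Peano continuum is a compact, connected, locally connected metric space. A map is essential if it is not homotopic to a constant map. A closed set $S\subset X$ separates $x$ from $y$ (with $x,y\notin S$) if $x$ and $y$ lie in different components of $X\setminus S$. If a group acts by homeomorphisms on a space $Y$, a sequence $(g_i)$ in the group acts as a convergence sequence on $Y$ if there exist points $n,p\in Y$ (possibly equal; called repeller and attractor) such that for every compact $C\subset Y$ with $n\notin C$, $g_i(C)\to p$, meaning that for every neighborhood $U$ of $p$ one has $g_i(C)\subset U$ for all sufficiently large $i$. The group acts as a convergence group on $Y$ if every sequence of distinct elements has a subsequence acting as a convergence sequence on $Y$. *)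

theory Defs
  imports "HOL-Analysis.Analysis" "HOL-Algebra.Group_Action"
begin

definition peano_continuum :: "'a::metric_space set \<Rightarrow> bool" where
  "peano_continuum X \<longleftrightarrow> X \<noteq> {} \<and> compact X \<and> connected X \<and> locally connected X"

definition cut_point :: "'a::topological_space set \<Rightarrow> 'a \<Rightarrow> bool" where
  "cut_point X x \<longleftrightarrow> x \<in> X \<and> \<not> connected (X - {x})"

definition essential_circle_map :: "'a::topological_space set \<Rightarrow> ('a \<Rightarrow> complex) \<Rightarrow> bool" where
  "essential_circle_map X f \<longleftrightarrow>
     continuous_on X f \<and> f ` X \<subseteq> sphere 0 1 \<and>
     \<not> (\<exists>c. homotopic_with_canon (\<lambda>_. True) X (sphere 0 1) f (\<lambda>_. c))"

definition separates :: "'a::topological_space set \<Rightarrow> 'a set \<Rightarrow> 'a \<Rightarrow> 'a \<Rightarrow> bool" where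
  "separates X S x y \<longleftrightarrow> x \<in> X - S \<and> y \<in> X - S \<and> \<not> connected_component (X - S) x y"

definition convergence_sequence ::
    "('g \<Rightarrow> 'a \<Rightarrow> 'a) \<Rightarrow> 'a::topological_space set \<Rightarrow> (nat \<Rightarrow> 'g) \<Rightarrow> bool" where
  "convergence_sequence phi Y g \<longleftrightarrow>
     (\<exists>n\<in>Y. \<exists>p\<in>Y. \<forall>C. compact C \<and> C \<subseteq> Y \<and> n \<notin> C \<longrightarrow>
        (\<forall>U. openin (top_of_set Y) U \<and> p \<in> U \<longrightarrow>
           (\<forall>\<^sub>F i in sequentially. phi (g i) ` C \<subseteq> U)))"

definition convergence_group ::
    "('g \<Rightarrow> 'a \<Rightarrow> 'a) \<Rightarrow> 'g set \<Rightarrow> 'a::topological_space set \<Rightarrow> bool" where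
  "convergence_group phi H Y \<longleftrightarrow>
     (\<forall>g::nat \<Rightarrow> 'g. inj g \<and> range g \<subseteq> H \<longrightarrow>
        (\<exists>r::nat \<Rightarrow> nat. strict_mono r \<and> convergence_sequence phi Y (g \<circ> r)))"

definition stabilizer_set :: "('g, 'b) monoid_scheme \<Rightarrow> ('g \<Rightarrow> 'a \<Rightarrow> 'a) \<Rightarrow> 'a set \<Rightarrow> 'g set" where
  "stabilizer_set G phi A = {g \<in> carrier G. phi g ` A = A}"

end

theory Submission
  imports Defs "HOL-Library.Diagonal_Subsequence"
begin

text \<open>
  Since \<open>X\<close> has no essential map to the circle, any two points are separated by a connected
  finite union of non-degenerate members of the family, and no point of \<open>X\<close> is a local cut point.
  By nullity and a diagonal argument, a sequence of distinct group elements has a subsequence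
  \<open>f\<close> such that the images of each member \<open>A\<close> either shrink to a point or are eventually a fixed
  member \<open>A'\<close>; in the second case the stabilizer hypothesis gives a repeller \<open>n\<close> in \<open>A\<close> and an
  attractor \<open>p\<close> in \<open>A'\<close>. As \<open>X\<close> has no cut points, a separator that shrinks to a point is
  squeezed together with one of its two sides, so of two points separated by it one has a
  neighbourhood that shrinks as well.

  The heart of the proof is that all members that do not shrink share the same \<open>n\<close> and \<open>p\<close>.
  Members with different such pairs cannot touch: near a common attractor this would contradict
  the absence of local cut points. Hence the non-shrinking members of a connected separator all
  have the same pair, and a descent on the finitely many large members excludes two different
  pairs. A separator of \<open>n\<close> from any other point then shrinks, so that every point except \<open>n\<close> has
  a neighbourhood shrinking to a point; connectedness of \<open>X - {n}\<close> makes this point unique.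
\<close>

section \<open>Circle maps and separation\<close>

text \<open>A real function that jumps by 1 may still be continuous modulo 1. Since circle maps on
  \<open>X\<close> lift to the reals, two real versions of one circle map that agree at one point
  and differ by 1 at another cannot both be continuous along connections of these points. Both uses
  of the missing essential maps rest on this. The main obstacle is that separators are given in the
  domain while limits of members live in the image, and the maps themselves have no limit. The
  bridge is to replace a separator of two repellers by the limits of its members: a compact
  connected set that misses these limits and has suitable end points pulls back, for large
  \<open>i\<close>, to a connected set that joins neighbourhoods of the repellers off the separator.
  A point shared by two touching members may wander. If their pairs differ, however, the image
  members meet in a finite set, so along a subsequence the images of the point are constant, and
  composing with one inverse map makes it a fixed point. This is why the hypotheses on a sequence
  must be stable under subsequences, composition and inversion.\<close>

lemma nullhomotopic_circle_map_lift:
  fixes f :: "'a::metric_space \<Rightarrow> complex"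
  assumes "compact X"
    and "homotopic_with_canon (\<lambda>_. True) X (sphere 0 1) f (\<lambda>_. c)"
  obtains \<theta> :: "'a \<Rightarrow> real" where "continuous_on X \<theta>" "\<And>x. x \<in> X \<Longrightarrow> f x = cis (\<theta> x)"
proof (cases "X = {}")
  case True
  then show ?thesis using that[of "\<lambda>_. 0"] by simp
next
  case False
  have "homotopic_with_canon (\<lambda>_. True) X (sphere 0 1) (\<lambda>_. c) f"
    using assms(2) homotopic_with_sym by blast
  then obtain h :: "real \<times> 'a \<Rightarrow> complex"
    where h: "continuous_on ({0..1} \<times> X) h" "h ` ({0..1} \<times> X) \<subseteq> sphere 0 1"
      and h0: "\<And>x. h (0, x) = c" and h1: "\<And>x. h (1, x) = f x"
    unfolding homotopic_with_def by (auto simp: image_subset_iff_funcset)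
  have nh: "norm (h (t, x)) = 1" if "t \<in> {0..1}" "x \<in> X" for t x
    using h(2) that by (auto simp: image_subset_iff)
  have "uniformly_continuous_on ({0..1} \<times> X) h"
    using h(1) assms(1) by (intro compact_uniformly_continuous compact_Times) auto
  then obtain d where d: "d > 0" and
    hd: "\<And>p q. \<lbrakk>p \<in> {0..1} \<times> X; q \<in> {0..1} \<times> X; dist p q < d\<rbrakk> \<Longrightarrow> dist (h p) (h q) < 1"
    unfolding uniformly_continuous_on_def by (metis zero_less_one dist_commute)
  \<comment> \<open>The homotopy is cut into \<open>N\<close> steps so short that consecutive stages
    differ by less than 1. Their quotient \<open>z\<close> then lies in the right half plane, where
    the principal \<open>Ln\<close> is continuous, and \<open>Im (Ln (z x))\<close> corrects the
    angle from one stage to the next.\<close>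
  obtain N :: nat where N: "N > 0" "1 / real N < d"
    using d real_arch_inverse[of d] by (metis inverse_eq_divide neq0_conv)
  have "k \<le> N \<Longrightarrow> \<exists>\<theta>::'a \<Rightarrow> real. continuous_on X \<theta> \<and> (\<forall>x\<in>X. h (real k / real N, x) = cis (\<theta> x))" for k
  proof (induction k)
    case 0
    have "norm c = 1" using nh[of 0] h0 False by auto
    then have "c = cis (Arg c)" using rcis_cmod_Arg[of c] by (simp add: rcis_def)
    then show ?case using h0 by (intro exI[of _ "\<lambda>_. Arg c"]) auto
  next
    case (Suc k)
    then obtain \<theta> where \<theta>: "continuous_on X \<theta>" "\<And>x. x \<in> X \<Longrightarrow> h (real k / real N, x) = cis (\<theta> x)"
      by auto
    define t where "t = real k / real N"
    define s where "s = real (Suc k) / real N"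
    have ts: "t \<in> {0..1}" "s \<in> {0..1}" "\<bar>s - t\<bar> < d"
      using Suc.prems N by (auto simp: t_def s_def divide_simps)
    define z where "z = (\<lambda>x. h (s, x) / h (t, x))"
    have nz: "norm (z x) = 1" if "x \<in> X" for x
      using nh[OF ts(1) that] nh[OF ts(2) that] by (simp add: z_def norm_divide)
    have z: "z x \<notin> \<real>\<^sub>\<le>\<^sub>0" if "x \<in> X" for x
    proof -
      have "dist (h (s, x)) (h (t, x)) < 1"
        using hd[of "(s, x)" "(t, x)"] ts that by (auto simp: dist_Pair_Pair dist_real_def)
      moreover have "norm (h (t, x) * (z x - 1)) = norm (h (s, x) - h (t, x))"
        using nh[OF ts(1) that] by (auto simp: z_def field_simps)
      ultimately have "norm (z x - 1) < 1"
        using nh[OF ts(1) that] by (simp add: norm_mult dist_norm)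
      then have "Re (z x) > 0" using abs_Re_le_cmod[of "z x - 1"] by simp
      then show ?thesis by (auto simp: complex_nonpos_Reals_iff)
    qed
    have hc: "continuous_on X (\<lambda>x. h (r, x))" if "r \<in> {0..1}" for r
      using that by (intro continuous_on_compose2[OF h(1)] continuous_intros) auto
    have "continuous_on X z"
      unfolding z_def using nh[OF ts(1)] ts
      by (intro continuous_intros hc) force+
    then have "continuous_on X (\<lambda>x. \<theta> x + Im (Ln (z x)))"
      using z \<theta>(1) by (intro continuous_intros) auto
    moreover have "h (s, x) = cis (\<theta> x + Im (Ln (z x)))" if "x \<in> X" for x
    proof -
      have z0: "z x \<noteq> 0" using nz[OF that] by auto
      have "Re (Ln (z x)) = 0" using nz[OF that] z0 by simp
      then have "Ln (z x) = \<i> * complex_of_real (Im (Ln (z x)))" by (simp add: complex_eq_iff)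
      then have "z x = cis (Im (Ln (z x)))"
        using exp_Ln[OF z0] by (metis cis_conv_exp)
      moreover have "h (s, x) = h (t, x) * z x"
        using nh[OF ts(1) that] by (auto simp: z_def)
      ultimately show ?thesis using \<theta>(2)[OF that] by (metis t_def cis_mult)
    qed
    ultimately show ?case unfolding s_def by blast
  qed
  from this[of N] obtain \<theta> where "continuous_on X \<theta>" "\<And>x. x \<in> X \<Longrightarrow> h (1, x) = cis (\<theta> x)"
    using N by auto
  then show ?thesis using that h1 by simp
qed

lemma continuous_Ints_valued_constant:
  fixes f :: "'a::metric_space \<Rightarrow> real"
  assumes "connected S" "continuous_on S f" "\<And>x. x \<in> S \<Longrightarrow> f x \<in> \<int>" "x \<in> S" "y \<in> S"
  shows "f x = f y"
proof -
  have "f constant_on S"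
  proof (rule continuous_discrete_range_constant[OF assms(1,2)])
    fix x assume x: "x \<in> S"
    have "1 \<le> norm (f y - f x)" if "y \<in> S" "f y \<noteq> f x" for y
      using assms(3)[OF x] assms(3)[OF that(1)] that(2)
      by (metis Ints_diff Ints_nonzero_abs_ge1 eq_iff_diff_eq_0 real_norm_def)
    then show "\<exists>e>0. \<forall>y. y \<in> S \<and> f y \<noteq> f x \<longrightarrow> e \<le> norm (f y - f x)"
      by (intro exI[of _ 1]) auto
  qed
  then show ?thesis using assms(4,5) by (metis constant_on_def)
qed

lemma closedin_top_of_subset:
  assumes "closedin (top_of_set X) S" "Z \<subseteq> X"
  shows "closedin (top_of_set Z) (S \<inter> Z)"
  using assms by (auto simp: closedin_closed)

locale simple_peano =
  fixes X :: "'a::metric_space set"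
  assumes compact_X: "compact X" and connected_X: "connected X"
    and locally_connected_X: "locally connected X"
    and no_cut_point: "x \<in> X \<Longrightarrow> connected (X - {x})"
    and circle_maps_inessential: "\<not> essential_circle_map X f"
begin

lemma closed_X: "closed X"
  by (simp add: compact_X compact_imp_closed)

text \<open>\<open>u\<close> itself may jump by integers. The contradictions below come from
  comparing the lift with \<open>u\<close> on connected sets where \<open>u\<close> happens to be
  continuous, so that the integer difference cannot change.\<close>

lemma lift_mod_1:
  fixes u :: "'a \<Rightarrow> real"
  assumes "continuous_on X (\<lambda>x. cis (2 * pi * u x))"
  obtains \<theta> :: "'a \<Rightarrow> real" where "continuous_on X \<theta>" "\<And>x. x \<in> X \<Longrightarrow> \<theta> x - u x \<in> \<int>"
proof -
  obtain c where "homotopic_with_canon (\<lambda>_. True) X (sphere 0 1) (\<lambda>x. cis (2 * pi * u x)) (\<lambda>_. c)"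
    using circle_maps_inessential[of "\<lambda>x. cis (2 * pi * u x)"] assms
    unfolding essential_circle_map_def by auto
  then obtain \<theta> where \<theta>: "continuous_on X \<theta>" "\<And>x. x \<in> X \<Longrightarrow> cis (2 * pi * u x) = cis (\<theta> x)"
    using nullhomotopic_circle_map_lift[OF compact_X] by metis
  show ?thesis
  proof
    show "continuous_on X (\<lambda>x. \<theta> x / (2 * pi))"
      using \<theta>(1) by (intro continuous_intros) auto
    fix x assume "x \<in> X"
    from \<theta>(2)[OF this] have "cis (\<theta> x - 2 * pi * u x) = 1"
      by (metis cis_divide cis_neq_zero divide_self)
    then obtain n :: int where "\<theta> x - 2 * pi * u x = of_int n * (2 * pi)"
      by (metis cis.sel(1) one_complex.sel(1) cos_one_2pi_int mult.assoc)
    then have "\<theta> x / (2 * pi) - u x = of_int n"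
      by (simp add: field_simps)
    then show "\<theta> x / (2 * pi) - u x \<in> \<int>" by simp
  qed
qed

lemma lift_difference_constant:
  fixes \<theta> u :: "'a \<Rightarrow> real"
  assumes "continuous_on X \<theta>" "E \<subseteq> X" "connected E" "continuous_on E u"
    "\<And>x. x \<in> E \<Longrightarrow> \<theta> x - u x \<in> \<int>" "x \<in> E" "y \<in> E"
  shows "\<theta> x - u x = \<theta> y - u y"
  using assms
  by (intro continuous_Ints_valued_constant[where f="\<lambda>x. \<theta> x - u x" and S=E])
     (auto intro!: continuous_intros intro: continuous_on_subset)

lemma openin_component_Diff:
  assumes "closed S"
  shows "openin (top_of_set X) (connected_component_set (X - S) x)"
proof (cases "x \<in> X - S")
  case True
  have "openin (top_of_set X) (X - S)"
    using assms by (metis Diff_eq open_Compl openin_open_Int)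
  then show ?thesis using locally_connected_2[OF locally_connected_X] True by blast
next
  case False
  then show ?thesis by (metis connected_component_eq_empty openin_empty)
qed

text \<open>A Janiszewski-type property of spaces without essential circle maps; it forces least
  separating families to be connected.\<close>

lemma separates_disjoint_Un:
  assumes cl: "closed P" "closed Q" "P \<subseteq> X" "Q \<subseteq> X" and disj: "P \<inter> Q = {}"
    and sep: "separates X (P \<union> Q) x y"
  shows "separates X P x y \<or> separates X Q x y"
proof (rule ccontr)
  assume neg: "\<not> ?thesis"
  have xy: "x \<in> X" "y \<in> X" "x \<notin> P" "x \<notin> Q" "y \<notin> P" "y \<notin> Q"
    and nc: "\<not> connected_component (X - (P \<union> Q)) x y"
    using sep by (auto simp: separates_def)
  have cP: "connected_component (X - P) x y" and cQ: "connected_component (X - Q) x y"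
    using neg xy by (auto simp: separates_def)
  have PQ: "P \<noteq> {}" "Q \<noteq> {}"
    using nc cP cQ by auto
  \<comment> \<open>The circle map runs once around the circle along \<open>U\<close>, from \<open>P\<close> to \<open>Q\<close>, and is constant
    elsewhere. A lift would compare the values at \<open>x\<close> and \<open>y\<close> differently in \<open>X - P\<close> and in \<open>X - Q\<close>.\<close>
  define U where "U = connected_component_set (X - (P \<union> Q)) x"
  have U: "U \<subseteq> X - (P \<union> Q)" "x \<in> U" "y \<notin> U"
    using nc xy connected_component_subset by (auto simp: U_def)
  have Uop: "openin (top_of_set X) U"
    unfolding U_def using cl by (intro openin_component_Diff) auto
  have Ucl: "closedin (top_of_set (X - (P \<union> Q))) U"
    unfolding U_def by (rule closedin_connected_component)
  obtain T where T: "closed T" "U = (X - (P \<union> Q)) \<inter> T"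
    using Ucl by (auto simp: closedin_closed)
  have clUPQ: "closedin (top_of_set X) (U \<union> P \<union> Q)"
  proof -
    have "U \<union> P \<union> Q = X \<inter> (T \<union> P \<union> Q)" using T cl(3,4) by auto
    then show ?thesis using T cl by (metis closed_Un closedin_closed_Int)
  qed
  have clXU: "closedin (top_of_set X) (X - U)"
    using Uop by (simp add: closedin_diff)
  define u0 where "u0 = (\<lambda>x. infdist x P / (infdist x P + infdist x Q))"
  have pos: "infdist x P + infdist x Q > 0" for x
    using in_closed_iff_infdist_zero[of P x] in_closed_iff_infdist_zero[of Q x] cl PQ disj
      infdist_nonneg[of x P] infdist_nonneg[of x Q]
    by (metis add_nonneg_nonneg add_nonneg_eq_0_iff disjoint_iff less_eq_real_def)
  have u0c: "continuous_on S u0" for S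
    unfolding u0_def using pos by (intro continuous_intros) (metis less_irrefl)+
  have u0P: "u0 z = 0" if "z \<in> P" for z
    using that by (simp add: u0_def)
  have u0Q: "u0 z = 1" if "z \<in> Q" for z
    using that pos[of z] by (simp add: u0_def)
  \<comment> \<open>Both \<open>k = 0\<close> and \<open>k = 1\<close> describe the same circle map.
    The frontier of \<open>U\<close> in \<open>X\<close> lies in \<open>P \<union> Q\<close>, and
    \<open>u0\<close> is 0 on \<open>P\<close> and 1 on \<open>Q\<close>, so \<open>u 1\<close> is
    continuous off \<open>P\<close> and \<open>u 0\<close> off \<open>Q\<close>. They agree at
    \<open>x\<close> in \<open>U\<close> and differ by 1 at \<open>y\<close> outside
    \<open>U\<close>.\<close>
  define u where "u = (\<lambda>k::real. \<lambda>x. if x \<in> U then u0 x else k)"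
  have "continuous_on ((U \<union> P \<union> Q) \<union> (X - U)) (\<lambda>x. if x \<in> U then cis (2 * pi * u0 x) else 1)"
  proof (rule continuous_on_cases_local)
    have eq: "(U \<union> P \<union> Q) \<union> (X - U) = X" using U(1) cl by auto
    show "closedin (top_of_set (U \<union> P \<union> Q \<union> (X - U))) (U \<union> P \<union> Q)"
      "closedin (top_of_set (U \<union> P \<union> Q \<union> (X - U))) (X - U)"
      unfolding eq using clUPQ clXU by auto
    show "continuous_on (U \<union> P \<union> Q) (\<lambda>x. cis (2 * pi * u0 x))"
      using u0c by (intro continuous_intros)
  qed (use U(1) u0P u0Q in \<open>auto simp: cis_2pi\<close>)
  moreover have "(U \<union> P \<union> Q) \<union> (X - U) = X" using U(1) cl by auto
  moreover have "(\<lambda>x. if x \<in> U then cis (2 * pi * u0 x) else 1) = (\<lambda>x. cis (2 * pi * u 0 x))"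
    by (auto simp: u_def)
  ultimately obtain \<theta> where \<theta>: "continuous_on X \<theta>" "\<And>x. x \<in> X \<Longrightarrow> \<theta> x - u 0 x \<in> \<int>"
    using lift_mod_1[of "u 0"] by metis
  have \<theta>1: "\<theta> x - u 1 x \<in> \<int>" if "x \<in> X" for x
    using \<theta>(2)[OF that] by (auto simp: u_def)
  have uc: "continuous_on (X - Z) (u k)"
    if Z: "Z = P \<and> k = 1 \<or> Z = Q \<and> k = 0" for Z k
  proof -
    let ?S = "(U \<union> P \<union> Q) \<inter> (X - Z)" and ?T = "(X - U) \<inter> (X - Z)"
    have eq: "?S \<union> ?T = X - Z" using U(1) cl by auto
    have "continuous_on (?S \<union> ?T) (u k)"
      unfolding u_def
    proof (rule continuous_on_cases_local)
      show "closedin (top_of_set (?S \<union> ?T)) ?S" "closedin (top_of_set (?S \<union> ?T)) ?T"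
        unfolding eq using clUPQ clXU
        by (auto intro: closedin_top_of_subset)
      show "continuous_on ?S u0" by (rule u0c)
    qed (use U(1) u0P u0Q Z in auto)
    then show ?thesis unfolding eq .
  qed
  have "\<theta> x - u 1 x = \<theta> y - u 1 y"
  proof -
    let ?E = "connected_component_set (X - P) x"
    have "?E \<subseteq> X - P" by (rule connected_component_subset)
    then show ?thesis using cP \<theta>1 xy uc[of P 1]
      by (intro lift_difference_constant[OF \<theta>(1), of ?E])
         (auto intro: continuous_on_subset)
  qed
  moreover have "\<theta> x - u 0 x = \<theta> y - u 0 y"
  proof -
    let ?E = "connected_component_set (X - Q) x"
    have "?E \<subseteq> X - Q" by (rule connected_component_subset)
    then show ?thesis using cQ \<theta>(2) xy uc[of Q 0]
      by (intro lift_difference_constant[OF \<theta>(1), of ?E])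
         (auto intro: continuous_on_subset)
  qed
  ultimately show False using U by (simp add: u_def)
qed

lemma no_local_cut_point:
  assumes W: "openin (top_of_set X) W" "connected W" and w: "w \<in> W"
  shows "connected (W - {w})"
proof (rule ccontr)
  assume "\<not> connected (W - {w})"
  then obtain E1 E2 where E: "openin (top_of_set (W - {w})) E1" "openin (top_of_set (W - {w})) E2"
    "E1 \<union> E2 = W - {w}" "E1 \<inter> E2 = {}" "E1 \<noteq> {}" "E2 \<noteq> {}"
    unfolding connected_openin_eq by blast
  have WX: "W \<subseteq> X" using W(1) by (simp add: openin_imp_subset)
  have "openin (top_of_set X) (W - {w})"
    using W(1) by (metis closed_singleton closedin_closed_Int inf.absorb_iff2 openin_delete)
  then have op: "openin (top_of_set X) E1" "openin (top_of_set X) E2"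
    using E(1,2) openin_trans by blast+
  \<comment> \<open>Here the circle map runs once around the circle along \<open>E1\<close>, starting at \<open>w\<close>; a lift would
    compare \<open>E1\<close> and \<open>E2\<close> differently in \<open>W\<close> and in \<open>X - {w}\<close>.\<close>
  obtain r where r: "r > 0" "ball w r \<inter> X \<subseteq> W"
    using W(1) w by (metis openin_contains_ball)
  \<comment> \<open>By the choice of \<open>r\<close> this is 0 at \<open>w\<close> and 1 throughout
    \<open>X - W\<close>. A point of \<open>X\<close> in neither \<open>E1\<close> nor
    \<open>E2\<close> is \<open>w\<close> or lies outside \<open>W\<close>, so filling up with 0 is
    continuous on \<open>W\<close> and filling up with 1 is continuous on
    \<open>X - {w}\<close>.\<close>
  define u0 where "u0 = (\<lambda>x. min 1 (dist x w / r))"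
  have u0c: "continuous_on S u0" for S
    unfolding u0_def using r by (intro continuous_intros) auto
  have u0w: "u0 w = 0" using r by (simp add: u0_def)
  have u0W: "u0 z = 1" if "z \<in> X" "z \<notin> W" for z
  proof -
    have "dist z w \<ge> r" using r that by (force simp: dist_commute)
    then show ?thesis using r by (simp add: u0_def)
  qed
  define u where "u = (\<lambda>k::real. \<lambda>x. if x \<in> E1 then u0 x else k)"
  have cl: "closedin (top_of_set X) (X - E2)" "closedin (top_of_set X) (X - E1)"
    using op by (simp_all add: closedin_diff)
  have eqX: "(X - E2) \<union> (X - E1) = X" using E by auto
  have "continuous_on ((X - E2) \<union> (X - E1)) (\<lambda>x. if x \<in> E1 then cis (2 * pi * u0 x) else 1)"
  proof (rule continuous_on_cases_local)
    show "continuous_on (X - E2) (\<lambda>x. cis (2 * pi * u0 x))"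
      using u0c by (intro continuous_intros)
    fix z assume "z \<in> X - E2 \<and> z \<notin> E1 \<or> z \<in> X - E1 \<and> z \<in> E1"
    then have "z = w \<or> z \<in> X \<and> z \<notin> W" using E(3) by auto
    then show "cis (2 * pi * u0 z) = 1" using u0w u0W by (auto simp: cis_2pi)
  qed (use cl in \<open>auto simp: eqX\<close>)
  moreover have "(\<lambda>x. if x \<in> E1 then cis (2 * pi * u0 x) else 1) = (\<lambda>x. cis (2 * pi * u 0 x))"
    by (auto simp: u_def)
  ultimately obtain \<theta> where \<theta>: "continuous_on X \<theta>" "\<And>x. x \<in> X \<Longrightarrow> \<theta> x - u 0 x \<in> \<int>"
    using lift_mod_1[of "u 0"] unfolding eqX by metis
  have \<theta>1: "\<theta> x - u 1 x \<in> \<int>" if "x \<in> X" for x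
    using \<theta>(2)[OF that] by (auto simp: u_def)
  have uc: "continuous_on Z (u k)"
    if Z: "Z = W \<and> k = 0 \<or> Z = X - {w} \<and> k = 1" for Z k
  proof -
    let ?S = "(X - E2) \<inter> Z" and ?T = "(X - E1) \<inter> Z"
    have eq: "?S \<union> ?T = Z" using eqX WX Z by auto
    have "continuous_on (?S \<union> ?T) (u k)"
      unfolding u_def
    proof (rule continuous_on_cases_local)
      show "closedin (top_of_set (?S \<union> ?T)) ?S" "closedin (top_of_set (?S \<union> ?T)) ?T"
        unfolding eq using cl Z WX
        by (auto intro: closedin_top_of_subset)
      show "continuous_on ?S u0" by (rule u0c)
      fix z assume "z \<in> ?S \<and> z \<notin> E1 \<or> z \<in> ?T \<and> z \<in> E1"
      then have "z = w \<and> Z = W \<or> z \<in> X \<and> z \<notin> W \<and> Z \<noteq> W" using E(3) Z w by auto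
      then show "u0 z = k" using u0w u0W Z w by auto
    qed auto
    then show ?thesis unfolding eq .
  qed
  obtain e1 e2 where e: "e1 \<in> E1" "e2 \<in> E2" using E by auto
  have "\<theta> e1 - u 0 e1 = \<theta> e2 - u 0 e2"
    using W WX e E(3) \<theta>(2) uc[of W 0]
    by (intro lift_difference_constant[OF \<theta>(1), of W]) auto
  moreover have "\<theta> e1 - u 1 e1 = \<theta> e2 - u 1 e2"
    using no_cut_point[of w] w WX e E(3) \<theta>1 uc[of "X - {w}" 1]
    by (intro lift_difference_constant[OF \<theta>(1), of "X - {w}"]) auto
  moreover have "e2 \<notin> E1" using e E(4) by auto
  ultimately show False using e(1) by (simp add: u_def)
qed

end

section \<open>Compact connected joining sets, and why small sets separate little\<close>

context simple_peano
begin

lemma small_connected_nhd: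
  assumes "openin (top_of_set X) U" "x \<in> U"
  obtains N where "openin (top_of_set X) N" "connected N" "x \<in> N" "closure N \<subseteq> U"
proof -
  obtain e where e: "e > 0" "ball x e \<inter> X \<subseteq> U"
    using assms by (metis openin_contains_ball)
  have "x \<in> X" using assms openin_imp_subset by blast
  then have "openin (top_of_set X) (X \<inter> ball x (e/2))" "x \<in> X \<inter> ball x (e/2)"
    using e by (auto simp: openin_open_Int)
  then obtain N where N: "openin (top_of_set X) N" "connected N" "x \<in> N" "N \<subseteq> X \<inter> ball x (e/2)"
    using locally_connected_X unfolding locally_connected by meson
  have "closure N \<subseteq> X \<inter> cball x (e/2)"
    using N(4) closed_X by (intro closure_minimal closed_Int) auto
  also have "\<dots> \<subseteq> U" using e by auto
  finally show ?thesis using that N by blast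
qed

text \<open>Being joined by a compact connected subset of \<open>U\<close> is an equivalence
  relation whose classes are open by local connectedness, so it is total on \<open>U\<close>.
  Finitely many small closures cover \<open>C\<close>, and each is tied to a base point
  \<open>c0\<close> by such a set.\<close>

lemma compact_connected_between:
  assumes U: "openin (top_of_set X) U" "connected U" and C: "compact C" "C \<subseteq> U"
  obtains K where "compact K" "connected K" "C \<subseteq> K" "K \<subseteq> U"
proof -
  define R where "R x y \<longleftrightarrow> (\<exists>K. compact K \<and> connected K \<and> K \<subseteq> U \<and> x \<in> K \<and> y \<in> K)" for x y
  have UX: "U \<subseteq> X" using U openin_imp_subset by blast
  have comp: "compact (closure N)" if "closure N \<subseteq> U" for N
    using that UX compact_X by (metis closed_closure compact_Int_closed inf.absorb_iff2 order_trans)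
  have R: "R x y" if "x \<in> U" "y \<in> U" for x y
  proof (rule connected_equivalence_relation[OF U(2) that])
    show "R x y \<Longrightarrow> R y x" for x y by (auto simp: R_def)
    show "R x z" if xyz: "R x y" "R y z" for x y z
    proof -
      obtain K L where "compact K" "connected K" "K \<subseteq> U" "x \<in> K" "y \<in> K"
        "compact L" "connected L" "L \<subseteq> U" "y \<in> L" "z \<in> L"
        using xyz unfolding R_def by blast
      then show ?thesis unfolding R_def
        by (intro exI[of _ "K \<union> L"]) (auto intro: connected_Un compact_Un)
    qed
    fix a assume a: "a \<in> U"
    obtain N where N: "openin (top_of_set X) N" "connected N" "a \<in> N" "closure N \<subseteq> U"
      using small_connected_nhd[OF U(1) a] by blast
    have "openin (top_of_set U) N"
      using N UX by (meson closure_subset openin_subset_trans order_trans)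
    moreover have "R a x" if "x \<in> N" for x
      unfolding R_def using N comp that connected_imp_connected_closure[of N] closure_subset[of N]
      by (intro exI[of _ "closure N"]) auto
    ultimately show "\<exists>T. openin (top_of_set U) T \<and> a \<in> T \<and> (\<forall>x\<in>T. R a x)"
      using N by blast
  qed
  show ?thesis
  proof (cases "C = {}")
    case True
    then show ?thesis using that[of "{}"] by auto
  next
    case False
    then obtain c0 where c0: "c0 \<in> C" by blast
    have "\<exists>T. open T \<and> c \<in> T \<and> connected (X \<inter> T) \<and> closure (X \<inter> T) \<subseteq> U" if c: "c \<in> C" for c
    proof -
      obtain N where "openin (top_of_set X) N" "connected N" "c \<in> N" "closure N \<subseteq> U"
        using small_connected_nhd[OF U(1), of c] C c by blast
      then show ?thesis by (metis IntD2 openin_open)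
    qed
    then obtain T where T: "\<And>c. c \<in> C \<Longrightarrow> open (T c) \<and> c \<in> T c \<and> connected (X \<inter> T c) \<and> closure (X \<inter> T c) \<subseteq> U"
      by metis
    obtain D where D: "D \<subseteq> C" "finite D" "C \<subseteq> (\<Union>c\<in>D. T c)"
      using compactE_image[OF C(1), of C T] T by blast
    have "\<exists>K. compact K \<and> connected K \<and> K \<subseteq> U \<and> c0 \<in> K \<and> c \<in> K" if "c \<in> C" for c
      using R[of c0 c] c0 that C by (auto simp: R_def)
    then obtain L where L: "\<And>c. c \<in> C \<Longrightarrow> compact (L c) \<and> connected (L c) \<and> L c \<subseteq> U \<and> c0 \<in> L c \<and> c \<in> L c"
      by metis
    define K where "K = (\<Union>c\<in>D. L c \<union> closure (X \<inter> T c))"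
    have cX: "c \<in> closure (X \<inter> T c)" if "c \<in> C" for c
      using T[OF that] that C UX closure_subset by blast
    have "connected (L c \<union> closure (X \<inter> T c))" if "c \<in> C" for c
      using L[OF that] T[OF that] cX[OF that] by (intro connected_Un connected_imp_connected_closure) auto
    then have "connected K"
      unfolding K_def using D L c0 by (intro connected_Union) blast+
    moreover have "compact K"
      unfolding K_def using D L T comp by (intro compact_UN compact_Un) auto
    moreover have "C \<subseteq> K"
    proof
      fix x assume x: "x \<in> C"
      then obtain c where "c \<in> D" "x \<in> X \<inter> T c" using D C(2) UX by blast
      then show "x \<in> K" using closure_subset[of "X \<inter> T c"] unfolding K_def by blast
    qed
    moreover have "K \<subseteq> U"
      unfolding K_def by (intro UN_least Un_least) (use L T D(1) in auto)
    ultimately show ?thesis using that by blast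
  qed
qed

text \<open>As \<open>q\<close> is not a cut point, the compact set \<open>X - ball q e\<close> lies
  in a compact connected \<open>K\<close> that avoids \<open>q\<close>. Any set inside a ball around
  \<open>q\<close> that misses \<open>K\<close> leaves \<open>K\<close> intact.\<close>

lemma small_set_does_not_separate:
  assumes "q \<in> X" "e > 0"
  obtains d where "d > 0"
    "\<And>S x y. \<lbrakk>S \<subseteq> cball q d; x \<in> X - ball q e; y \<in> X - ball q e\<rbrakk> \<Longrightarrow> connected_component (X - S) x y"
proof -
  have "openin (top_of_set X) (X - {q})"
    by (metis Diff_eq closed_singleton open_Compl openin_open_Int)
  moreover have "compact (X - ball q e)"
    using compact_X by (simp add: compact_diff)
  ultimately obtain K where K: "compact K" "connected K" "X - ball q e \<subseteq> K" "K \<subseteq> X - {q}"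
    using compact_connected_between[of "X - {q}" "X - ball q e"] no_cut_point[OF assms(1)] assms(2)
    by (metis Diff_mono centre_in_ball order_refl singletonD subsetI)
  have "open (- K)" "q \<in> - K" using K by (auto simp: compact_imp_closed)
  then obtain d where d: "d > 0" "cball q d \<subseteq> - K"
    using open_contains_cball by metis
  show ?thesis
  proof (rule that[OF d(1)])
    fix S x y assume "S \<subseteq> cball q d" "x \<in> X - ball q e" "y \<in> X - ball q e"
    then show "connected_component (X - S) x y"
      unfolding connected_component_def using K d by (intro exI[of _ K]) blast
  qed
qed

text \<open>The bound is uniform in the centre: centres of ever smaller separating sets would
  accumulate at some \<open>l\<close>, and infiniteness leaves points of \<open>A\<close> and
  \<open>B\<close> other than \<open>l\<close>, which small sets near \<open>l\<close> do not
  separate. This supplies the constant of the descent in \<open>single_type\<close>.\<close>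

lemma small_set_does_not_separate_sets:
  assumes "A \<subseteq> X" "B \<subseteq> X" "infinite A" "infinite B"
  obtains d where "d > 0"
    "\<And>S q. \<lbrakk>q \<in> X; S \<subseteq> cball q d\<rbrakk> \<Longrightarrow> \<exists>a\<in>A. \<exists>b\<in>B. connected_component (X - S) a b"
proof (rule ccontr)
  assume neg: "\<not> thesis"
  have "\<exists>q S. q \<in> X \<and> S \<subseteq> cball q (inverse (Suc n)) \<and> (\<forall>a\<in>A. \<forall>b\<in>B. \<not> connected_component (X - S) a b)" for n
    using neg that[of "inverse (Suc n)"] by fastforce
  then obtain q S where q: "\<And>n::nat. q n \<in> X" "\<And>n. S n \<subseteq> cball (q n) (inverse (Suc n))"
    "\<And>n a b. a \<in> A \<Longrightarrow> b \<in> B \<Longrightarrow> \<not> connected_component (X - S n) a b"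
    by metis
  obtain l r where l: "l \<in> X" "strict_mono r" "(q \<circ> r) \<longlonglongrightarrow> l"
    using compact_X q(1) unfolding compact_def by metis
  obtain a b where ab: "a \<in> A" "b \<in> B" "a \<noteq> l" "b \<noteq> l"
    using assms(3,4) by (metis finite.emptyI finite_insert insertCI rev_finite_subset subsetI)
  define e where "e = min (dist l a) (dist l b)"
  have e: "e > 0" "a \<notin> ball l e" "b \<notin> ball l e" using ab by (auto simp: e_def)
  obtain d where d: "d > 0" "\<And>S x y. \<lbrakk>S \<subseteq> cball l d; x \<in> X - ball l e; y \<in> X - ball l e\<rbrakk> \<Longrightarrow> connected_component (X - S) x y"
    using small_set_does_not_separate[OF l(1) e(1)] by blast
  have "(\<lambda>n. dist l (q (r n)) + inverse (Suc (r n))) \<longlonglongrightarrow> dist l l + 0"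
    using l(3) LIMSEQ_subseq_LIMSEQ[OF LIMSEQ_inverse_real_of_nat l(2)]
    by (intro tendsto_intros) (auto simp: o_def)
  then have "\<forall>\<^sub>F n in sequentially. dist l (q (r n)) + inverse (Suc (r n)) < d"
    using d(1) by (auto dest: order_tendstoD(2))
  then obtain n where n: "dist l (q (r n)) + inverse (Suc (r n)) < d"
    by (auto simp: eventually_sequentially)
  have "S (r n) \<subseteq> cball l d"
  proof
    fix z assume "z \<in> S (r n)"
    then have "dist (q (r n)) z \<le> inverse (Suc (r n))" using q(2) by force
    then show "z \<in> cball l d" using n dist_triangle[of l z "q (r n)"] by simp
  qed
  then show False using d(2) q(3) ab e assms by blast
qed

text \<open>A separating subfamily of least cardinality is connected and has no degenerate member.\<close>

lemma separates_connected_subfamily: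
  assumes "finite \<B>" "\<And>B. B \<in> \<B> \<Longrightarrow> closed B \<and> connected B \<and> B \<subseteq> X"
    "separates X (\<Union>\<B>) x y"
  obtains \<C> where "\<C> \<subseteq> \<B>" "connected (\<Union>\<C>)" "separates X (\<Union>\<C>) x y" "\<And>B. B \<in> \<C> \<Longrightarrow> infinite B"
proof -
  define Sep where "Sep \<C> \<longleftrightarrow> \<C> \<subseteq> \<B> \<and> separates X (\<Union>\<C>) x y" for \<C>
  have "Sep \<B>" using assms by (simp add: Sep_def)
  then obtain \<C> where C: "Sep \<C>" and min: "\<And>\<D>. Sep \<D> \<Longrightarrow> card \<C> \<le> card \<D>"
    using ex_has_least_nat[of Sep \<B> card] by blast
  have sub: "\<C> \<subseteq> \<B>" and sep: "separates X (\<Union>\<C>) x y" and fin: "finite \<C>"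
    using C assms(1) by (auto simp: Sep_def intro: finite_subset)
  have proper: False if "\<D> \<subset> \<C>" "separates X (\<Union>\<D>) x y" for \<D>
    using min[of \<D>] that sub fin psubset_card_mono[of \<C> \<D>] by (force simp: Sep_def)
  have clU: "closed (\<Union>\<D>)" and subU: "\<Union>\<D> \<subseteq> X" if "\<D> \<subseteq> \<C>" for \<D>
    using that sub fin assms(2) by (auto intro!: closed_Union intro: finite_subset)
  have "connected (\<Union>\<C>)"
  proof (rule ccontr)
    assume "\<not> connected (\<Union>\<C>)"
    then obtain P Q where PQ: "closed P" "closed Q" "P \<noteq> {}" "Q \<noteq> {}" "P \<union> Q = \<Union>\<C>" "P \<inter> Q = {}"
      using connected_closed_set[OF clU[OF order_refl]] by auto
    have side: "B \<subseteq> P \<or> B \<subseteq> Q" if "B \<in> \<C>" for B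
    proof -
      have "connected B" using that sub assms(2) by blast
      moreover have "B \<subseteq> P \<union> Q" using PQ that by blast
      ultimately show ?thesis using PQ
        unfolding connected_closed by blast
    qed
    have part: "\<Union>{B\<in>\<C>. B \<subseteq> Z} = Z" if Z: "Z = P \<or> Z = Q" for Z
    proof (intro equalityI subsetI)
      fix z assume z: "z \<in> Z"
      then obtain B where "B \<in> \<C>" "z \<in> B" using PQ(5) Z by blast
      then show "z \<in> \<Union>{B\<in>\<C>. B \<subseteq> Z}" using side[of B] PQ(6) z Z by auto
    qed auto
    have P: "\<Union>{B\<in>\<C>. B \<subseteq> P} = P" and Q: "\<Union>{B\<in>\<C>. B \<subseteq> Q} = Q"
      using part by auto
    have "P \<noteq> \<Union>\<C>" "Q \<noteq> \<Union>\<C>" using PQ(3-6) by auto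
    then have "{B\<in>\<C>. B \<subseteq> P} \<subset> \<C>" "{B\<in>\<C>. B \<subseteq> Q} \<subset> \<C>"
      using P Q by (metis (no_types, lifting) mem_Collect_eq psubsetI subsetI)+
    then have "\<not> separates X P x y" "\<not> separates X Q x y"
      using proper P Q by metis+
    moreover have "P \<subseteq> X" "Q \<subseteq> X" using PQ subU[of \<C>] by blast+
    ultimately show False
      using separates_disjoint_Un[of P Q x y] PQ sep by metis
  qed
  moreover have "infinite B" if B: "B \<in> \<C>" for B
  proof
    assume "finite B"
    then have "B = {} \<or> (\<exists>b. B = {b})"
      using B sub assms(2) connected_finite_iff_sing by blast
    \<comment> \<open>By minimality a degenerate member contributes a point \<open>b\<close> outside
      the other members. Then \<open>{b}\<close> or the union of the others separates already: the
      first would make \<open>b\<close> a cut point, the second contradicts minimality.\<close>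
    moreover have "\<Union>(\<C> - {B}) \<noteq> \<Union>\<C>"
      using proper[of "\<C> - {B}"] sep B by (metis Diff_subset DiffD2 psubsetI singletonI)
    ultimately obtain b where b: "B = {b}" "b \<notin> \<Union>(\<C> - {B})" using B by blast
    have "b \<in> X" using b B subU[of \<C>] by blast
    have "\<Union>\<C> = {b} \<union> \<Union>(\<C> - {B})" using b B by blast
    then have "separates X {b} x y \<or> separates X (\<Union>(\<C> - {B})) x y"
      using b sep \<open>b \<in> X\<close> clU[of "\<C> - {B}"] subU[of "\<C> - {B}"]
      by (intro separates_disjoint_Un) auto
    moreover have "\<not> separates X {b} x y"
      using no_cut_point[OF \<open>b \<in> X\<close>]
      by (auto simp: separates_def connected_iff_connected_component)
    ultimately show False using proper[of "\<C> - {B}"] B by blast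
  qed
  ultimately show ?thesis using that sub sep by blast
qed

end

section \<open>Limits of members under a sequence of homeomorphisms\<close>

definition tends :: "(nat \<Rightarrow> 'a \<Rightarrow> 'a::topological_space) \<Rightarrow> 'a set \<Rightarrow> 'a \<Rightarrow> bool" where
  "tends f N q \<longleftrightarrow> (\<forall>U. open U \<and> q \<in> U \<longrightarrow> (\<forall>\<^sub>F i in sequentially. f i ` N \<subseteq> U))"

text \<open>The convergence condition is phrased with neighbourhoods of both points, so that it is
  symmetric under inverting the maps and exchanging \<open>n\<close> and \<open>p\<close>.\<close>

definition moves ::
    "(nat \<Rightarrow> 'a \<Rightarrow> 'a::topological_space) \<Rightarrow> 'a set \<Rightarrow> 'a set \<Rightarrow> 'a \<Rightarrow> 'a \<Rightarrow> bool" where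
  "moves f A A' n p \<longleftrightarrow> n \<in> A \<and> p \<in> A' \<and> (\<forall>\<^sub>F i in sequentially. f i ` A = A') \<and>
     (\<forall>U V. open U \<and> p \<in> U \<and> open V \<and> n \<in> V \<longrightarrow> (\<forall>\<^sub>F i in sequentially. f i ` (A - V) \<subseteq> U))"

text \<open>One limit notion for both outcomes, so that shrinking and non-shrinking members of a
  separator can be treated alike.\<close>

definition lims :: "(nat \<Rightarrow> 'a \<Rightarrow> 'a::topological_space) \<Rightarrow> 'a set \<Rightarrow> 'a set \<Rightarrow> bool" where
  "lims f B Z \<longleftrightarrow> (\<exists>q. Z = {q} \<and> tends f B q) \<or> (\<exists>n p. moves f B Z n p)"

lemma tends_mono:
  assumes "tends f N q" "M \<subseteq> N"
  shows "tends f M q"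
  unfolding tends_def
proof (intro allI impI)
  fix U assume "open U \<and> q \<in> U"
  then have "\<forall>\<^sub>F i in sequentially. f i ` N \<subseteq> U" using assms(1) by (simp add: tends_def)
  then show "\<forall>\<^sub>F i in sequentially. f i ` M \<subseteq> U"
    by (rule eventually_mono) (use assms(2) in auto)
qed

lemma tends_tendsto:
  assumes "tends f N q" "x \<in> N"
  shows "(\<lambda>i. f i x) \<longlonglongrightarrow> q"
proof (rule topological_tendstoI)
  fix U assume "open U" "q \<in> U"
  then have "\<forall>\<^sub>F i in sequentially. f i ` N \<subseteq> U" using assms(1) by (simp add: tends_def)
  then show "\<forall>\<^sub>F i in sequentially. f i x \<in> U"
    by (rule eventually_mono) (use assms(2) in auto)
qed

lemma tends_Union:
  assumes "finite \<B>" "\<And>B. B \<in> \<B> \<Longrightarrow> tends f B q"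
  shows "tends f (\<Union>\<B>) q"
  unfolding tends_def
proof (intro allI impI)
  fix U assume "open U \<and> q \<in> U"
  then have "\<forall>\<^sub>F i in sequentially. \<forall>B\<in>\<B>. f i ` B \<subseteq> U"
    using assms by (intro eventually_ball_finite) (auto simp: tends_def)
  then show "\<forall>\<^sub>F i in sequentially. f i ` \<Union>\<B> \<subseteq> U"
    by eventually_elim auto
qed

lemma moves_tendsto:
  fixes f :: "nat \<Rightarrow> 'a \<Rightarrow> 'a::metric_space"
  assumes "moves f A A' n p" "x \<in> A" "x \<noteq> n"
  shows "(\<lambda>i. f i x) \<longlonglongrightarrow> p"
proof (rule topological_tendstoI)
  fix U :: "'a set" assume "open U" "p \<in> U"
  moreover have "open (- {x})" "n \<in> - {x}" using assms by auto
  ultimately have "\<forall>\<^sub>F i in sequentially. f i ` (A - (- {x})) \<subseteq> U"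
    using assms unfolding moves_def by blast
  then show "\<forall>\<^sub>F i in sequentially. f i x \<in> U"
    by (rule eventually_mono) (use assms(2) in auto)
qed

lemma infinite_avoid2:
  assumes "infinite A"
  obtains a where "a \<in> A" "a \<noteq> p" "a \<noteq> q"
proof -
  have "\<not> A \<subseteq> {p, q}" using assms finite_subset by blast
  then show ?thesis using that by blast
qed

text \<open>This is the family after degenerate members have been discarded and separators made
  connected. Infinite members always leave a point away from two prescribed ones, such as an
  attractor and a competing limit.\<close>

locale fine_family = simple_peano X for X :: "'a::metric_space set" +
  fixes \<A> :: "'a set set"
  assumes closed_member: "A \<in> \<A> \<Longrightarrow> closed A"
    and connected_member: "A \<in> \<A> \<Longrightarrow> connected A"
    and member_subset: "A \<in> \<A> \<Longrightarrow> A \<subseteq> X"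
    and infinite_member: "A \<in> \<A> \<Longrightarrow> infinite A"
    and null: "e > 0 \<Longrightarrow> finite {A \<in> \<A>. diameter A > e}"
    and fine: "\<lbrakk>x \<in> X; y \<in> X; x \<noteq> y\<rbrakk> \<Longrightarrow>
      \<exists>\<B>. finite \<B> \<and> \<B> \<subseteq> \<A> \<and> connected (\<Union>\<B>) \<and> separates X (\<Union>\<B>) x y"
begin

lemma closed_Union_members: "finite \<B> \<Longrightarrow> \<B> \<subseteq> \<A> \<Longrightarrow> closed (\<Union>\<B>)"
  using closed_member by (auto intro!: closed_Union)

lemma Union_members_subset: "\<B> \<subseteq> \<A> \<Longrightarrow> \<Union>\<B> \<subseteq> X"
  using member_subset by blast

definition regular :: "(nat \<Rightarrow> 'a \<Rightarrow> 'a) \<Rightarrow> 'a \<Rightarrow> bool" where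
  "regular f x \<longleftrightarrow> (\<exists>N q. openin (top_of_set X) N \<and> x \<in> N \<and> q \<in> X \<and> tends f N q)"

definition homeos :: "(nat \<Rightarrow> 'a \<Rightarrow> 'a) \<Rightarrow> (nat \<Rightarrow> 'a \<Rightarrow> 'a) \<Rightarrow> bool" where
  "homeos f f' \<longleftrightarrow> (\<forall>i. homeomorphism X X (f i) (f' i) \<and> (\<forall>A\<in>\<A>. f i ` A \<in> \<A> \<and> f' i ` A \<in> \<A>))"

definition dichotomy :: "(nat \<Rightarrow> 'a \<Rightarrow> 'a) \<Rightarrow> bool" where
  "dichotomy f \<longleftrightarrow> (\<forall>A\<in>\<A>. (\<exists>q\<in>X. tends f A q) \<or> (\<exists>A' n p. moves f A A' n p))"

text \<open>Which side of a shrinking separator is squeezed may change with the index, so this has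
  to be arranged by passing to a subsequence.\<close>

definition focusing :: "(nat \<Rightarrow> 'a \<Rightarrow> 'a) \<Rightarrow> bool" where
  "focusing f \<longleftrightarrow> (\<forall>\<B> q x y. finite \<B> \<and> \<B> \<subseteq> \<A> \<and> q \<in> X \<and> tends f (\<Union>\<B>) q \<and>
      separates X (\<Union>\<B>) x y \<longrightarrow> regular f x \<or> regular f y)"

end

text \<open>The inverse maps satisfy the same demands, so each result can be reused with repeller
  and attractor exchanged.\<close>

locale good_sequence = fine_family X \<A> for X :: "'a::metric_space set" and \<A> +
  fixes f f' :: "nat \<Rightarrow> 'a \<Rightarrow> 'a"
  assumes homeos: "homeos f f'"
    and dichotomy: "dichotomy f" and dichotomy_inverse: "dichotomy f'"
    and focusing: "focusing f" and focusing_inverse: "focusing f'"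
begin

lemma good_sequence_inverse: "good_sequence X \<A> f' f"
proof unfold_locales
  show "homeos f' f" using homeos unfolding homeos_def by (auto intro: homeomorphism_symD)
qed (fact dichotomy dichotomy_inverse focusing focusing_inverse)+

lemma homeo: "homeomorphism X X (f i) (f' i)"
  and image_member: "A \<in> \<A> \<Longrightarrow> f i ` A \<in> \<A>"
  and image_inv_member: "A \<in> \<A> \<Longrightarrow> f' i ` A \<in> \<A>"
  using homeos unfolding homeos_def by auto

lemma inv_left: "x \<in> X \<Longrightarrow> f' i (f i x) = x"
  and inv_right: "x \<in> X \<Longrightarrow> f i (f' i x) = x"
  and f_in: "x \<in> X \<Longrightarrow> f i x \<in> X"
  and f'_in: "x \<in> X \<Longrightarrow> f' i x \<in> X"
  and cont: "continuous_on X (f i)"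
  and cont': "continuous_on X (f' i)"
  using homeo[of i] unfolding homeomorphism_def by auto

lemma image_image_inv:
  assumes "B \<subseteq> X"
  shows "f' i ` f i ` B = B" and "f i ` f' i ` B = B"
proof -
  have "(\<lambda>x. f' i (f i x)) ` B = (\<lambda>x. x) ` B" "(\<lambda>x. f i (f' i x)) ` B = (\<lambda>x. x) ` B"
    using assms by (intro image_cong; auto simp: inv_left inv_right)+
  then show "f' i ` f i ` B = B" "f i ` f' i ` B = B" by (simp_all add: image_image)
qed

lemma f_eq_iff: "x \<in> X \<Longrightarrow> y \<in> X \<Longrightarrow> f i x = f i y \<longleftrightarrow> x = y"
  by (metis inv_left)

lemma moves_member:
  assumes "moves f A A' n p" "A \<in> \<A>"
  shows "A' \<in> \<A>"
proof -
  obtain i where "f i ` A = A'"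
    using assms unfolding moves_def eventually_sequentially by auto
  then show ?thesis using image_member[OF assms(2)] by blast
qed

lemma moves_inverse:
  assumes "moves f A A' n p" "A \<in> \<A>"
  shows "moves f' A' A p n"
proof -
  have AX: "A \<subseteq> X" using assms member_subset by auto
  have ev: "\<forall>\<^sub>F i in sequentially. f i ` A = A'"
    and np: "n \<in> A" "p \<in> A'"
    using assms unfolding moves_def by auto
  have "\<forall>\<^sub>F i in sequentially. f' i ` A' = A"
    using ev by (rule eventually_mono) (use image_image_inv(1)[OF AX] in auto)
  moreover have "\<forall>\<^sub>F i in sequentially. f' i ` (A' - V) \<subseteq> U"
    if UV: "open U" "n \<in> U" "open V" "p \<in> V" for U V
  proof -
    have "\<forall>\<^sub>F i in sequentially. f i ` (A - U) \<subseteq> V"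
      using assms UV unfolding moves_def by blast
    with ev show ?thesis
    proof eventually_elim
      case (elim i)
      show ?case
      proof clarify
        fix y assume "y \<in> A'" "y \<notin> V"
        then obtain a where "a \<in> A" "y = f i a" using elim by auto
        moreover then have "f' i y = a" using AX inv_left by auto
        moreover have "a \<in> U"
          using elim(2) \<open>y \<notin> V\<close> \<open>a \<in> A\<close> \<open>y = f i a\<close> by auto
        ultimately show "f' i y \<in> U" by simp
      qed
    qed
  qed
  ultimately show ?thesis using np unfolding moves_def by auto
qed

lemma moves_tendsto_inverse:
  assumes "moves f A A' n p" "A \<in> \<A>" "y \<in> A'" "y \<noteq> p"
  shows "(\<lambda>i. f' i y) \<longlonglongrightarrow> n"
  using moves_tendsto[OF moves_inverse[OF assms(1,2)] assms(3,4)] .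

text \<open>Some \<open>a\<close> in \<open>A'\<close> differs from \<open>p\<close> and from the
  supposed limit \<open>q\<close>. Its preimages \<open>f' i a\<close> tend to \<open>n\<close> and
  so enter any neighbourhood of \<open>n\<close>, whose images therefore keep hitting
  \<open>a\<close> and cannot shrink to \<open>q\<close>.\<close>

lemma repeller_not_regular:
  assumes "moves f A A' n p" "A \<in> \<A>"
  shows "\<not> regular f n"
proof
  assume "regular f n"
  then obtain N q where N: "openin (top_of_set X) N" "n \<in> N" "tends f N q"
    unfolding regular_def by blast
  obtain T where T: "open T" "N = X \<inter> T" using N(1) by (auto simp: openin_open)
  obtain a where a: "a \<in> A'" "a \<noteq> p" "a \<noteq> q"
    using infinite_avoid2 infinite_member[OF moves_member[OF assms]] by metis
  have aX: "a \<in> X" using a moves_member[OF assms] member_subset by blast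
  have "\<forall>\<^sub>F i in sequentially. f' i a \<in> T"
    using moves_tendsto_inverse[OF assms a(1,2)] T N(2) by (auto dest: topological_tendstoD)
  moreover have "\<forall>\<^sub>F i in sequentially. f i ` N \<subseteq> - {a}"
    using N(3) a(3) unfolding tends_def by auto
  ultimately have "\<forall>\<^sub>F i in sequentially. False"
  proof eventually_elim
    case (elim i)
    then have "f' i a \<in> N" using T f'_in[OF aX] by auto
    then have "f i (f' i a) \<noteq> a" using elim by blast
    then show False using inv_right[OF aX] by simp
  qed
  then show False by simp
qed

lemma lims_exists:
  assumes "B \<in> \<A>"
  shows "\<exists>Z. lims f B Z"
proof -
  from dichotomy assms consider q where "tends f B q" | A' n p where "moves f B A' n p"
    unfolding dichotomy_def by auto
  then show ?thesis unfolding lims_def by cases auto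
qed

lemma lims_choice:
  assumes "\<B> \<subseteq> \<A>"
  obtains Z where "\<And>B. B \<in> \<B> \<Longrightarrow> lims f B (Z B)"
proof -
  have "\<forall>B\<in>\<B>. \<exists>Z. lims f B Z" using lims_exists assms by blast
  then obtain Z where "\<forall>B\<in>\<B>. lims f B (Z B)" by (rule bchoice[elim_format]) blast
  then show ?thesis using that by blast
qed

lemma lims_closed: "lims f B Z \<Longrightarrow> B \<in> \<A> \<Longrightarrow> closed Z"
  using moves_member closed_member unfolding lims_def by auto

lemma lims_nonempty: "lims f B Z \<Longrightarrow> Z \<noteq> {}"
  unfolding lims_def moves_def by auto

lemma lims_attract:
  assumes "lims f B Z" "open U" "Z \<subseteq> U"
  shows "\<forall>\<^sub>F i in sequentially. f i ` B \<subseteq> U"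
  using assms(1) unfolding lims_def
proof (elim disjE exE conjE)
  fix q assume "Z = {q}" "tends f B q"
  then show ?thesis using assms unfolding tends_def by auto
next
  fix n p assume "moves f B Z n p"
  then show ?thesis using assms unfolding moves_def by (auto elim: eventually_mono)
qed

lemma lims_attract_family:
  assumes "finite \<B>" "\<And>B. B \<in> \<B> \<Longrightarrow> lims f B (Z B)" "open U" "(\<Union>B\<in>\<B>. Z B) \<subseteq> U"
  shows "\<forall>\<^sub>F i in sequentially. f i ` \<Union>\<B> \<subseteq> U"
proof -
  have "\<forall>\<^sub>F i in sequentially. \<forall>B\<in>\<B>. f i ` B \<subseteq> U"
  proof (intro eventually_ball_finite ballI)
    fix B assume "B \<in> \<B>"
    then show "\<forall>\<^sub>F i in sequentially. f i ` B \<subseteq> U"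
      using assms(2-4) by (intro lims_attract[of B "Z B"]) auto
  qed (fact assms(1))
  then show ?thesis by eventually_elim auto
qed

lemma lims_in:
  assumes "lims f B Z" "B \<in> \<A>" "x \<in> B" "(\<lambda>i. f i x) \<longlonglongrightarrow> y"
  shows "y \<in> Z"
proof (rule ccontr)
  assume "y \<notin> Z"
  then obtain U V where UV: "open U" "open V" "y \<in> U" "Z \<subseteq> V" "U \<inter> V = {}"
    using t4_space[of "{y}" Z] lims_closed[OF assms(1,2)] by auto
  have "\<forall>\<^sub>F i in sequentially. f i x \<in> U"
    using UV assms(4) by (auto dest: topological_tendstoD)
  moreover have "\<forall>\<^sub>F i in sequentially. f i ` B \<subseteq> V"
    using lims_attract assms UV by blast
  ultimately have "\<forall>\<^sub>F i in sequentially. False"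
    by eventually_elim (use assms(3) UV in blast)
  then show False by simp
qed

text \<open>Disjoint closed groups of limits have disjoint open neighbourhoods, which for large
  \<open>i\<close> would split the connected image of the union under \<open>f i\<close>. In use,
  \<C> collects the members whose limits have some property, and all members turn out to have
  it.\<close>

lemma lims_connected:
  assumes fin: "finite \<B>" and sub: "\<B> \<subseteq> \<A>" and conn: "connected (\<Union>\<B>)"
    and lims: "\<And>B. B \<in> \<B> \<Longrightarrow> lims f B (Z B)"
    and C: "\<C> \<subseteq> \<B>" "\<C> \<noteq> {}" and disj: "(\<Union>B\<in>\<C>. Z B) \<inter> (\<Union>B\<in>\<B> - \<C>. Z B) = {}"
  shows "\<C> = \<B>"
proof (rule ccontr)
  assume "\<C> \<noteq> \<B>"
  then obtain B1 B2 where B: "B1 \<in> \<C>" "B2 \<in> \<B> - \<C>" using C by blast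
  have "closed (Z B)" if "B \<in> \<B>" for B
    using lims_closed[OF lims[OF that]] sub that by blast
  then have "closed (\<Union>B\<in>\<C>. Z B)" "closed (\<Union>B\<in>\<B> - \<C>. Z B)"
    using fin finite_subset[OF C(1) fin] C(1) by (auto intro!: closed_UN)
  then obtain U V where UV: "open U" "open V" "(\<Union>B\<in>\<C>. Z B) \<subseteq> U" "(\<Union>B\<in>\<B> - \<C>. Z B) \<subseteq> V" "U \<inter> V = {}"
    using t4_space disj by metis
  have "\<forall>\<^sub>F i in sequentially. f i ` \<Union>\<C> \<subseteq> U"
    using UV fin C lims by (intro lims_attract_family[where Z=Z]) (auto intro: finite_subset)
  moreover have "\<forall>\<^sub>F i in sequentially. f i ` \<Union>(\<B> - \<C>) \<subseteq> V"
    using UV fin C lims by (intro lims_attract_family[where Z=Z]) auto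
  ultimately have "\<forall>\<^sub>F i in sequentially. f i ` \<Union>\<C> \<subseteq> U \<and> f i ` \<Union>(\<B> - \<C>) \<subseteq> V"
    by (rule eventually_conj)
  then obtain i where i: "f i ` \<Union>\<C> \<subseteq> U" "f i ` \<Union>(\<B> - \<C>) \<subseteq> V"
    using eventually_happens'[OF sequentially_bot] by blast
  have "connected (f i ` \<Union>\<B>)"
    using conn cont[of i] Union_members_subset[OF sub]
    by (meson connected_continuous_image continuous_on_subset)
  moreover have "f i ` \<Union>\<B> \<subseteq> f i ` \<Union>\<C> \<union> f i ` \<Union>(\<B> - \<C>)" by blast
  then have "f i ` \<Union>\<B> \<subseteq> U \<union> V" using i by (meson Un_mono order_trans)
  moreover have "U \<inter> V \<inter> f i ` \<Union>\<B> = {}" using UV(5) by simp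
  ultimately have "U \<inter> f i ` \<Union>\<B> = {} \<or> V \<inter> f i ` \<Union>\<B> = {}"
    using UV(1,2) by (metis connectedD)
  moreover obtain b1 b2 where "b1 \<in> B1" "b2 \<in> B2"
    using B C sub infinite_member[of B1] infinite_member[of B2] by (metis DiffD1 ex_in_conv finite.emptyI subsetD)
  then have "b1 \<in> \<Union>\<C>" "b2 \<in> \<Union>(\<B> - \<C>)" "b1 \<in> \<Union>\<B>" "b2 \<in> \<Union>\<B>"
    using B C by auto
  then have "f i b1 \<in> U \<inter> f i ` \<Union>\<B>" "f i b2 \<in> V \<inter> f i ` \<Union>\<B>"
    using i by (meson IntI image_eqI subsetD)+
  ultimately show False by auto
qed

text \<open>If \<open>K\<close> missed all limits, then for large \<open>i\<close> its preimage
  under \<open>f i\<close> would miss \<open>\<Union>\<B>\<close>. As \<open>a1\<close> and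
  \<open>a2\<close> are not the attractors, \<open>f' i a1\<close> and \<open>f' i a2\<close> tend
  to the repellers and end up in the open components of \<open>n1\<close> and \<open>n2\<close>,
  which the preimage of \<open>K\<close> would join.\<close>

lemma connected_through_limits:
  assumes fin: "finite \<B>" and sub: "\<B> \<subseteq> \<A>"
    and sep: "separates X (\<Union>\<B>) n1 n2"
    and lims: "\<And>B. B \<in> \<B> \<Longrightarrow> lims f B (Z B)"
    and m1: "moves f A1 A1' n1 p1" "A1 \<in> \<A>" "a1 \<in> A1'" "a1 \<noteq> p1"
    and m2: "moves f A2 A2' n2 p2" "A2 \<in> \<A>" "a2 \<in> A2'" "a2 \<noteq> p2"
    and K: "compact K" "connected K" "K \<subseteq> X" "a1 \<in> K" "a2 \<in> K"
  obtains B where "B \<in> \<B>" "Z B \<inter> K \<noteq> {}"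
proof (rule ccontr)
  assume "\<not> thesis"
  then have "(\<Union>B\<in>\<B>. Z B) \<subseteq> - K" using that by blast
  then have ev: "\<forall>\<^sub>F i in sequentially. f i ` \<Union>\<B> \<subseteq> - K"
    using fin lims K by (intro lims_attract_family[where Z=Z]) (auto simp: compact_imp_closed)
  define V where "V n = connected_component_set (X - \<Union>\<B>) n" for n
  have evV: "\<forall>\<^sub>F i in sequentially. f' i a \<in> V n"
    if "moves f A A' n p" "A \<in> \<A>" "a \<in> A'" "a \<noteq> p" "n \<in> X - \<Union>\<B>" for a A A' n p
  proof -
    have "openin (top_of_set X) (V n)"
      unfolding V_def using closed_Union_members[OF fin sub] openin_component_Diff by blast
    then obtain T where T: "open T" "V n = X \<inter> T" by (auto simp: openin_open)
    have "n \<in> V n" using that(5) by (auto simp: V_def)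
    then have "\<forall>\<^sub>F i in sequentially. f' i a \<in> T"
      using moves_tendsto_inverse[OF that(1-4)] T by (auto dest: topological_tendstoD)
    moreover have "a \<in> X" using moves_member[OF that(1,2)] member_subset that(3) by blast
    ultimately show ?thesis using T f'_in by (auto elim: eventually_mono)
  qed
  have n: "n1 \<in> X - \<Union>\<B>" "n2 \<in> X - \<Union>\<B>" "\<not> connected_component (X - \<Union>\<B>) n1 n2"
    using sep by (auto simp: separates_def)
  have "\<forall>\<^sub>F i in sequentially. False"
    using ev evV[OF m1 n(1)] evV[OF m2 n(2)]
  proof eventually_elim
    case (elim i)
    have "connected (f' i ` K)"
      using K cont' by (meson connected_continuous_image continuous_on_subset)
    moreover have "f' i ` K \<subseteq> X - \<Union>\<B>"
    proof clarify
      fix k assume "k \<in> K"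
      moreover then have "f i (f' i k) = k" "k \<in> X" using K inv_right by auto
      ultimately show "f' i k \<in> X - \<Union>\<B>" using elim(1) f'_in
        by (metis ComplD DiffI image_eqI subsetD)
    qed
    ultimately have "connected_component (X - \<Union>\<B>) (f' i a1) (f' i a2)"
      using K unfolding connected_component_def by blast
    moreover have "connected_component (X - \<Union>\<B>) n1 (f' i a1)" "connected_component (X - \<Union>\<B>) n2 (f' i a2)"
      using elim by (auto simp: V_def)
    ultimately have "connected_component (X - \<Union>\<B>) n1 n2"
      by (meson connected_component_sym connected_component_trans)
    then show False using n by blast
  qed
  then show False by simp
qed

end

section \<open>Stability under subsequences and under composition with a fixed homeomorphism\<close>

lemma tends_subseq:
  assumes "tends f N q" "strict_mono r"
  shows "tends (\<lambda>i. f (r i)) N q"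
  using assms eventually_subseq[OF assms(2)] unfolding tends_def by auto

lemma moves_subseq:
  assumes "moves f A A' n p" "strict_mono r"
  shows "moves (\<lambda>i. f (r i)) A A' n p"
  using assms eventually_subseq[OF assms(2)] unfolding moves_def by auto

lemma moves_image:
  assumes "moves f A A' n p"
  obtains i where "f i ` A = A'"
proof -
  have "\<forall>\<^sub>F i in sequentially. f i ` A = A'" using assms by (simp add: moves_def)
  then have "\<exists>i. f i ` A = A'" by (rule eventually_happens'[OF sequentially_bot])
  then show ?thesis using that by blast
qed

lemma moves_pre:
  assumes hom: "homeomorphism X X k k'" and "A \<subseteq> X" and mv: "moves f (k ` A) A' n p"
  shows "moves (\<lambda>i. f i \<circ> k) A A' (k' n) p"
proof -
  have kk: "k' (k x) = x" if "x \<in> X" for x using hom that by (simp add: homeomorphism_def)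
  have contk: "continuous_on X k'" and kX: "k ` X = X" "k' ` X = X" using hom by (auto simp: homeomorphism_def)
  obtain a where a: "a \<in> A" "n = k a" using mv by (auto simp: moves_def)
  have n: "k' n = a" using a kk assms(2) by auto
  have "\<forall>\<^sub>F i in sequentially. (f i \<circ> k) ` (A - V) \<subseteq> U"
    if UV: "open U" "p \<in> U" "open V" "k' n \<in> V" for U V
  proof -
    have "openin (top_of_set X) (X \<inter> k' -` V)"
      using contk UV(3) continuous_openin_preimage_gen by blast
    then obtain T where T: "open T" "X \<inter> k' -` V = X \<inter> T" by (auto simp: openin_open)
    have "n \<in> X" using a assms(2) kX by auto
    then have "n \<in> T" using T UV(4) by auto
    then have "\<forall>\<^sub>F i in sequentially. f i ` (k ` A - T) \<subseteq> U"
      using mv UV T unfolding moves_def by blast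
    moreover have "k ` (A - V) \<subseteq> k ` A - T"
    proof clarify
      fix x assume x: "x \<in> A" "x \<notin> V"
      then have "k x \<in> X" "k' (k x) = x" using kX kk assms(2) by blast+
      then have "k x \<notin> X \<inter> T" using x(2) T(2) by (metis IntD2 vimageD)
      then show "k x \<in> k ` A - T" using x \<open>k x \<in> X\<close> by blast
    qed
    ultimately show ?thesis
      by (elim eventually_mono) (metis image_comp image_mono order_trans)
  qed
  moreover have "\<forall>\<^sub>F i in sequentially. (f i \<circ> k) ` A = A'"
    using mv unfolding moves_def image_comp[symmetric] by blast
  ultimately show ?thesis
    using mv n a unfolding moves_def by blast
qed

lemma tends_post:
  fixes X :: "'a::topological_space set"
  assumes k: "continuous_on X k" and f: "\<And>i. f i ` X \<subseteq> X" and "N \<subseteq> X" "q \<in> X" and t: "tends f N q"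
  shows "tends (\<lambda>i. k \<circ> f i) N (k q)"
  unfolding tends_def
proof (intro allI impI)
  fix U assume U: "open U \<and> k q \<in> U"
  then have "openin (top_of_set X) (X \<inter> k -` U)"
    using k continuous_openin_preimage_gen by blast
  then obtain T where T: "open T" "X \<inter> k -` U = X \<inter> T" by (auto simp: openin_open)
  have "q \<in> T" using T U assms by auto
  then have "\<forall>\<^sub>F i in sequentially. f i ` N \<subseteq> T"
    using t T unfolding tends_def by blast
  then show "\<forall>\<^sub>F i in sequentially. (k \<circ> f i) ` N \<subseteq> U"
  proof (rule eventually_mono)
    fix i assume i: "f i ` N \<subseteq> T"
    have "f i ` N \<subseteq> X" using f[of i] assms(3) by blast
    then show "(k \<circ> f i) ` N \<subseteq> U" using i T by auto
  qed
qed

lemma moves_post: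
  fixes X :: "'a::topological_space set"
  assumes k: "continuous_on X k" and f: "\<And>i. f i ` X \<subseteq> X" and "A \<subseteq> X" "A' \<subseteq> X"
    and mv: "moves f A A' n p"
  shows "moves (\<lambda>i. k \<circ> f i) A (k ` A') n (k p)"
proof -
  have pX: "p \<in> X" using mv assms(4) by (auto simp: moves_def)
  have "\<forall>\<^sub>F i in sequentially. (k \<circ> f i) ` (A - V) \<subseteq> U"
    if UV: "open U" "k p \<in> U" "open V" "n \<in> V" for U V
  proof -
    have "tends f (A - V) p" using mv UV unfolding tends_def moves_def by auto
    then have "tends (\<lambda>i. k \<circ> f i) (A - V) (k p)"
      using assms pX by (intro tends_post[OF k f]) auto
    then show ?thesis using UV unfolding tends_def by auto
  qed
  moreover have "\<forall>\<^sub>F i in sequentially. (k \<circ> f i) ` A = k ` A'"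
  proof -
    have "\<forall>\<^sub>F i in sequentially. f i ` A = A'" using mv by (simp add: moves_def)
    then show ?thesis by (rule eventually_mono) (auto simp: image_comp[symmetric])
  qed
  ultimately show ?thesis using mv unfolding moves_def by auto
qed

lemma tends_pre: "tends f (k ` N) q \<Longrightarrow> tends (\<lambda>i. f i \<circ> k) N q"
  unfolding tends_def by (simp add: image_comp)

lemma separates_homeomorphic:
  assumes hom: "homeomorphism X X k k'" and "R \<subseteq> X" and sep: "separates X R x y"
  shows "separates X (k ` R) (k x) (k y)"
proof -
  have kX: "k ` X = X" and k': "continuous_on X k'" and kk: "\<And>x. x \<in> X \<Longrightarrow> k' (k x) = x" "k' ` X = X"
    and kk': "\<And>x. x \<in> X \<Longrightarrow> k (k' x) = x"
    using hom by (auto simp: homeomorphism_def)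
  have inj: "inj_on k X" using kk by (metis inj_onI)
  have xy: "x \<in> X - R" "y \<in> X - R" using sep by (auto simp: separates_def)
  then have "k x \<in> X - k ` R" "k y \<in> X - k ` R"
    using kX inj assms(2) by (auto simp: inj_on_def)
  moreover have "\<not> connected_component (X - k ` R) (k x) (k y)"
  proof
    assume "connected_component (X - k ` R) (k x) (k y)"
    then obtain T where T: "connected T" "T \<subseteq> X - k ` R" "k x \<in> T" "k y \<in> T"
      by (auto simp: connected_component_def)
    have "connected (k' ` T)"
      using T k' by (meson Diff_subset connected_continuous_image continuous_on_subset order_trans)
    moreover have "k' ` T \<subseteq> X - R"
    proof clarify
      fix t assume t: "t \<in> T"
      then have "k (k' t) = t" "k' t \<in> X" using T(2) t kk' kk(2) by blast+
      then show "k' t \<in> X - R" using T t by (metis DiffI DiffD2 image_eqI subsetD)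
    qed
    moreover have "x \<in> k' ` T" "y \<in> k' ` T" using T kk xy by (metis DiffD1 image_eqI)+
    ultimately show False using sep unfolding separates_def connected_component_def by blast
  qed
  ultimately show ?thesis by (simp add: separates_def)
qed

context fine_family
begin

lemma regular_subseq: "regular f x \<Longrightarrow> strict_mono r \<Longrightarrow> regular (\<lambda>i. f (r i)) x"
  unfolding regular_def using tends_subseq by blast

lemma homeos_image: "homeos f f' \<Longrightarrow> f i ` X = X"
  unfolding homeos_def homeomorphism_def by auto

lemma regular_post:
  assumes "homeomorphism X X k k'" "homeos f f'" "regular f x"
  shows "regular (\<lambda>i. k \<circ> f i) x"
proof -
  obtain N q where N: "openin (top_of_set X) N" "x \<in> N" "q \<in> X" "tends f N q"
    using assms(3) by (auto simp: regular_def)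
  have k: "continuous_on X k" "k ` X = X" using assms(1) by (auto simp: homeomorphism_def)
  have "tends (\<lambda>i. k \<circ> f i) N (k q)"
    using N openin_imp_subset[OF N(1)] homeos_image[OF assms(2)] by (intro tends_post[OF k(1)]) auto
  then show ?thesis using N k unfolding regular_def by blast
qed

lemma regular_pre:
  assumes hom: "homeomorphism X X k k'" and "x \<in> X" "regular f (k x)"
  shows "regular (\<lambda>i. f i \<circ> k) x"
proof -
  obtain N q where N: "openin (top_of_set X) N" "k x \<in> N" "q \<in> X" "tends f N q"
    using assms(3) by (auto simp: regular_def)
  have k: "continuous_on X k" "k ` X = X" using hom by (auto simp: homeomorphism_def)
  have "openin (top_of_set X) (X \<inter> k -` N)"
    using k N(1) by (metis continuous_openin_preimage image_subset_iff_funcset order_refl)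
  moreover have "tends (\<lambda>i. f i \<circ> k) (X \<inter> k -` N) q"
    using N(4) by (intro tends_pre tends_mono[OF N(4)]) auto
  ultimately show ?thesis using N assms(2) unfolding regular_def by blast
qed

lemma dichotomy_subseq: "dichotomy f \<Longrightarrow> strict_mono r \<Longrightarrow> dichotomy (\<lambda>i. f (r i))"
  unfolding dichotomy_def by (blast intro: tends_subseq moves_subseq)

lemma dichotomy_post:
  assumes k: "homeomorphism X X k k'" and f: "homeos f f'" and d: "dichotomy f"
  shows "dichotomy (\<lambda>i. k \<circ> f i)"
  unfolding dichotomy_def
proof
  fix A assume A: "A \<in> \<A>"
  have kc: "continuous_on X k" "k ` X = X" using k by (auto simp: homeomorphism_def)
  have fX: "f i ` X \<subseteq> X" for i using homeos_image[OF f] by auto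
  from d A consider q where "q \<in> X" "tends f A q" | A' n p where "moves f A A' n p"
    unfolding dichotomy_def by auto
  then show "(\<exists>q\<in>X. tends (\<lambda>i. k \<circ> f i) A q) \<or> (\<exists>A' n p. moves (\<lambda>i. k \<circ> f i) A A' n p)"
  proof cases
    case 1
    then have "tends (\<lambda>i. k \<circ> f i) A (k q)"
      by (intro tends_post[OF kc(1) fX member_subset[OF A]])
    moreover have "k q \<in> X" using 1 kc(2) by blast
    ultimately show ?thesis by blast
  next
    case 2
    then obtain i where "f i ` A = A'" by (rule moves_image)
    then have "A' \<subseteq> X" using fX[of i] member_subset[OF A] by blast
    then have "moves (\<lambda>i. k \<circ> f i) A (k ` A') n (k p)"
      using 2 by (intro moves_post[OF kc(1) fX member_subset[OF A]])
    then show ?thesis by blast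
  qed
qed

lemma dichotomy_pre:
  assumes k: "homeomorphism X X k k'" and kA: "\<And>A. A \<in> \<A> \<Longrightarrow> k ` A \<in> \<A>" and d: "dichotomy f"
  shows "dichotomy (\<lambda>i. f i \<circ> k)"
  unfolding dichotomy_def
proof
  fix A assume A: "A \<in> \<A>"
  from d kA[OF A] consider q where "q \<in> X" "tends f (k ` A) q" | A' n p where "moves f (k ` A) A' n p"
    unfolding dichotomy_def by auto
  then show "(\<exists>q\<in>X. tends (\<lambda>i. f i \<circ> k) A q) \<or> (\<exists>A' n p. moves (\<lambda>i. f i \<circ> k) A A' n p)"
    using tends_pre moves_pre[OF k member_subset[OF A]] by cases blast+
qed

text \<open>Besides shrinking, \<open>dichotomy\<close> leaves only images that are eventually one
  infinite member, and these cannot shrink along a subsequence. Otherwise the premise of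
  \<open>focusing\<close> could hold for a subsequence alone, and \<open>focusing\<close> need not
  be inherited.\<close>

lemma tends_of_subseq:
  assumes f: "homeos f f'" "dichotomy f" and r: "strict_mono r" and B: "B \<in> \<A>"
    and t: "tends (\<lambda>i. f (r i)) B q"
  shows "tends f B q"
proof -
  from f(2) B consider q' where "tends f B q'" | A' n p where "moves f B A' n p"
    unfolding dichotomy_def by auto
  then show ?thesis
  proof cases
    case 1
    obtain b where b: "b \<in> B" using infinite_member[OF B] by fastforce
    have "(\<lambda>i. f (r i) b) \<longlonglongrightarrow> q'" "(\<lambda>i. f (r i) b) \<longlonglongrightarrow> q"
      using tends_tendsto[OF tends_subseq[OF 1 r] b] tends_tendsto[OF t b] .
    then show ?thesis using 1 LIMSEQ_unique by blast
  next
    case 2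
    then obtain i where "f i ` B = A'" by (rule moves_image)
    then have A': "A' \<in> \<A>" using f(1) B unfolding homeos_def by blast
    obtain a where a: "a \<in> A'" "a \<noteq> q" using infinite_avoid2[OF infinite_member[OF A']] by metis
    have "\<forall>\<^sub>F i in sequentially. f (r i) ` B = A'"
      using moves_subseq[OF 2 r] by (simp add: moves_def)
    moreover have "\<forall>\<^sub>F i in sequentially. f (r i) ` B \<subseteq> - {a}"
      using t a unfolding tends_def by auto
    ultimately have "\<forall>\<^sub>F i::nat in sequentially. False"
      by eventually_elim (use a in auto)
    then show ?thesis by simp
  qed
qed

lemma focusing_subseq:
  assumes f: "homeos f f'" "dichotomy f" and r: "strict_mono r" and foc: "focusing f"
  shows "focusing (\<lambda>i. f (r i))"
  unfolding focusing_def
proof (intro allI impI, elim conjE)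
  fix \<B> q x y
  assume B: "finite \<B>" "\<B> \<subseteq> \<A>" "q \<in> X" "tends (\<lambda>i. f (r i)) (\<Union>\<B>) q" "separates X (\<Union>\<B>) x y"
  have "tends f B q" if "B \<in> \<B>" for B
    using tends_of_subseq[OF f r] tends_mono[OF B(4)] B(2) that by blast
  then have "tends f (\<Union>\<B>) q" by (rule tends_Union[OF B(1)])
  then have "regular f x \<or> regular f y" using foc B unfolding focusing_def by blast
  then show "regular (\<lambda>i. f (r i)) x \<or> regular (\<lambda>i. f (r i)) y" using regular_subseq r by blast
qed

lemma focusing_post:
  assumes k: "homeomorphism X X k k'" and f: "homeos f f'" and d: "focusing f"
  shows "focusing (\<lambda>i. k \<circ> f i)"
  unfolding focusing_def
proof (intro allI impI, elim conjE)
  fix \<B> q x y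
  assume B: "finite \<B>" "\<B> \<subseteq> \<A>" "q \<in> X" "tends (\<lambda>i. k \<circ> f i) (\<Union>\<B>) q" "separates X (\<Union>\<B>) x y"
  have kX: "k ` X = X" "k' ` X = X" "continuous_on X k'" "\<And>x. x \<in> X \<Longrightarrow> k' (k x) = x"
    using k by (auto simp: homeomorphism_def)
  have fX: "f i ` X = X" for i using homeos_image[OF f] .
  have sub: "\<Union>\<B> \<subseteq> X" using Union_members_subset[OF B(2)] .
  have "(k \<circ> f i) ` X \<subseteq> X" for i using fX kX by (auto simp: image_comp[symmetric])
  then have *: "tends (\<lambda>i. k' \<circ> (k \<circ> f i)) (\<Union>\<B>) (k' q)"
    using B(3,4) by (intro tends_post[OF kX(3) _ sub]) auto
  have "(k' \<circ> (k \<circ> f i)) ` \<Union>\<B> = f i ` \<Union>\<B>" for i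
  proof (rule image_cong[OF refl])
    fix x assume "x \<in> \<Union>\<B>"
    then have "f i x \<in> X" using sub fX[of i] by blast
    then show "(k' \<circ> (k \<circ> f i)) x = f i x" using kX(4) by simp
  qed
  then have "tends f (\<Union>\<B>) (k' q)" using * unfolding tends_def by simp
  moreover have "k' q \<in> X" using kX B(3) by blast
  ultimately have "regular f x \<or> regular f y"
    using d B unfolding focusing_def by blast
  then show "regular (\<lambda>i. k \<circ> f i) x \<or> regular (\<lambda>i. k \<circ> f i) y"
    using regular_post[OF k f] by blast
qed

lemma focusing_pre:
  assumes k: "homeomorphism X X k k'" and kA: "\<And>A. A \<in> \<A> \<Longrightarrow> k ` A \<in> \<A>" and d: "focusing f"
  shows "focusing (\<lambda>i. f i \<circ> k)"
  unfolding focusing_def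
proof (intro allI impI, elim conjE)
  fix \<B> q x y
  assume B: "finite \<B>" "\<B> \<subseteq> \<A>" "q \<in> X" "tends (\<lambda>i. f i \<circ> k) (\<Union>\<B>) q" "separates X (\<Union>\<B>) x y"
  have un: "k ` \<Union>\<B> = \<Union>((`) k ` \<B>)" by blast
  have "tends f (k ` \<Union>\<B>) q" using B(4) unfolding tends_def by (simp add: image_comp)
  moreover have "separates X (k ` \<Union>\<B>) (k x) (k y)"
    using separates_homeomorphic[OF k Union_members_subset[OF B(2)] B(5)] .
  moreover have "finite ((`) k ` \<B>)" "(`) k ` \<B> \<subseteq> \<A>" using B kA by auto
  ultimately have "regular f (k x) \<or> regular f (k y)"
    using d[unfolded focusing_def, rule_format, of "(`) k ` \<B>" q "k x" "k y"] B(3) by (simp add: un)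
  moreover have "x \<in> X" "y \<in> X" using B(5) by (auto simp: separates_def)
  ultimately show "regular (\<lambda>i. f i \<circ> k) x \<or> regular (\<lambda>i. f i \<circ> k) y"
    using regular_pre[OF k] by blast
qed

end

context good_sequence
begin

lemma moves_unique:
  assumes "moves f A A' n p" "moves f A B' m q" "A \<in> \<A>"
  shows "A' = B'" "n = m" "p = q"
proof -
  have "\<forall>\<^sub>F i in sequentially. f i ` A = A'" "\<forall>\<^sub>F i in sequentially. f i ` A = B'"
    using assms by (auto simp: moves_def)
  then have "\<forall>\<^sub>F i::nat in sequentially. A' = B'" by eventually_elim simp
  then show AB: "A' = B'" by simp
  obtain a where "a \<in> A" "a \<noteq> n" "a \<noteq> m" using infinite_avoid2 infinite_member[OF assms(3)] by metis
  then show "p = q" using moves_tendsto assms(1,2) LIMSEQ_unique by metis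
  obtain a where "a \<in> A'" "a \<noteq> p" "a \<noteq> q"
    using infinite_avoid2 infinite_member[OF moves_member[OF assms(1,3)]] by metis
  then show "n = m" using moves_tendsto_inverse assms AB LIMSEQ_unique by metis
qed

lemma fixed_point_in_member:
  assumes "moves f B Z n p" "B \<in> \<A>" "w \<in> Z" "\<And>i. f i w = w" "w \<in> X"
  shows "w \<in> B"
proof -
  obtain i where "f i ` B = Z" using assms(1) by (rule moves_image)
  then obtain b where "b \<in> B" "f i b = w" using assms(3) by auto
  then show ?thesis using f_eq_iff[of b w i] member_subset[OF assms(2)] assms(4,5) by auto
qed

text \<open>Every member of a connected separator of \<open>n\<close> and \<open>w\<close> that meets \<open>A\<close> has \<open>w\<close> in its limit, and
  by \<open>fixed_point_in_member\<close> it then shrinks to \<open>w\<close>. Connectedness carries this over to the whole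
  separator, which therefore pinches off a neighbourhood of \<open>w\<close>.\<close>

lemma attractor_regular:
  assumes mv: "moves f A A n w" and A: "A \<in> \<A>" and fp: "\<And>i. f i w = w" and "n \<noteq> w"
  shows "regular f w"
proof -
  have wn: "w \<in> A" "n \<in> A" using mv by (auto simp: moves_def)
  then have wnX: "w \<in> X" "n \<in> X" using member_subset[OF A] by auto
  obtain \<B> where B: "finite \<B>" "\<B> \<subseteq> \<A>" "connected (\<Union>\<B>)" "separates X (\<Union>\<B>) n w"
    using fine[OF wnX(2,1) assms(4)] by blast
  have notin: "n \<notin> \<Union>\<B>" "w \<notin> \<Union>\<B>" using B(4) by (auto simp: separates_def)
  obtain Z where Z: "\<And>B. B \<in> \<B> \<Longrightarrow> lims f B (Z B)" using lims_choice[OF B(2)] by blast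
  have shrink: "Z B = {w}" "tends f B w" if "B \<in> \<B>" "w \<in> Z B" for B
  proof -
    have "B \<in> \<A>" "w \<notin> B" using that B notin by auto
    then have "\<not> moves f B (Z B) n' p'" for n' p'
      using fixed_point_in_member[OF _ _ that(2) fp wnX(1)] by blast
    moreover have "lims f B (Z B)" using Z that(1) by blast
    ultimately obtain q where "Z B = {q}" "tends f B q" unfolding lims_def by blast
    then show "Z B = {w}" "tends f B w" using that(2) by auto
  qed
  have "A \<inter> \<Union>\<B> \<noteq> {}"
  proof
    assume "A \<inter> \<Union>\<B> = {}"
    then have "A \<subseteq> X - \<Union>\<B>" using member_subset[OF A] by blast
    then have "connected_component (X - \<Union>\<B>) n w"
      using wn connected_member[OF A] unfolding connected_component_def by blast
    then show False using B(4) by (simp add: separates_def)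
  qed
  then obtain y B0 where y: "y \<in> A" "y \<in> B0" "B0 \<in> \<B>" by blast
  have "y \<noteq> n" using y notin by blast
  then have "w \<in> Z B0"
    using lims_in[OF Z[OF y(3)] _ y(2) moves_tendsto[OF mv y(1)]] y(3) B(2) by blast
  have "{B\<in>\<B>. w \<in> Z B} = \<B>"
  proof (rule lims_connected[OF B(1-3) Z])
    show "{B \<in> \<B>. w \<in> Z B} \<noteq> {}" using y(3) \<open>w \<in> Z B0\<close> by blast
    show "\<Union> (Z ` {B \<in> \<B>. w \<in> Z B}) \<inter> \<Union> (Z ` (\<B> - {B \<in> \<B>. w \<in> Z B})) = {}"
      using shrink(1) by fastforce
  qed auto
  then have "tends f (\<Union>\<B>) w"
    using shrink(2) by (intro tends_Union[OF B(1)]) blast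
  then have "regular f n \<or> regular f w"
    using focusing B wnX(1) unfolding focusing_def by blast
  then show ?thesis using repeller_not_regular[OF mv A] by blast
qed

end

section \<open>Touching members\<close>

lemma connected_infinite_accumulates:
  fixes A :: "'a::metric_space set"
  assumes "connected A" "infinite A" "w \<in> A" "open T" "w \<in> T"
  obtains a where "a \<in> A" "a \<in> T" "a \<noteq> w"
proof (rule ccontr)
  assume "\<not> thesis"
  then have "A \<inter> T = {w}" using that assms by blast
  then have "openin (top_of_set A) {w}" using assms(4) by (metis openin_open)
  moreover have "closedin (top_of_set A) {w}" using assms(3) by (simp add: closed_subset)
  ultimately have "A = {w}" using assms(1) unfolding connected_clopen by blast
  then show False using assms(2) by simp
qed

context good_sequence
begin

lemma moves_attractor_fixed:
  assumes "moves f C C' c p" "w \<in> C" "w \<noteq> c" "\<And>i. f i w = w"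
  shows "p = w"
proof -
  have "(\<lambda>i::nat. w) \<longlonglongrightarrow> p" using moves_tendsto[OF assms(1-3)] assms(4) by simp
  then show ?thesis by (metis LIMSEQ_const_iff)
qed

text \<open>Only finitely many non-shrinking members pass through a fixed attractor \<open>w\<close>, since
  their repellers stay away from \<open>w\<close>. As \<open>w\<close> is not a local cut point, two members with different
  repellers that are adjacent around \<open>w\<close> can be joined near \<open>w\<close> off all the others, which
  no separator of the two repellers permits.\<close>

lemma sink_unique:
  assumes mA: "moves f A A n w" and A: "A \<in> \<A>" and nw: "n \<noteq> w"
    and mB: "moves f B B m w'" and B: "B \<in> \<A>" and wB: "w \<in> B"
    and fp: "\<And>i. f i w = w"
  shows "m = n" "w' = w"
proof -
  have wA: "w \<in> A" "n \<in> A" using mA by (auto simp: moves_def)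
  then have wX: "w \<in> X" "n \<in> X" using member_subset[OF A] by auto
  have reg: "regular f w" by (rule attractor_regular[OF mA A fp nw])
  have src: "c \<noteq> w" "p = w" if "moves f C C' c p" "C \<in> \<A>" "w \<in> C" for C C' c p
  proof -
    show "c \<noteq> w" using repeller_not_regular[OF that(1,2)] reg by auto
    then show "p = w" using moves_attractor_fixed[OF that(1,3) _ fp] by auto
  qed
  show w': "w' = w" using src(2)[OF mB B wB] .
  show "m = n"
  proof (rule ccontr)
    assume mn: "m \<noteq> n"
    obtain W0 q where W0: "openin (top_of_set X) W0" "w \<in> W0" "q \<in> X" "tends f W0 q"
      using reg by (auto simp: regular_def)
    obtain e where e: "e > 0" "ball w e \<inter> X \<subseteq> W0"
      using W0(1,2) by (metis openin_contains_ball)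
    define \<S> where "\<S> = {C \<in> \<A>. w \<in> C \<and> (\<exists>C' c. moves f C C' c w)}"
    \<comment> \<open>Halving \<open>e\<close> turns the bound \<open>dist w c \<ge> e\<close> into
      the strict inequality of \<open>null\<close>.\<close>
    have "\<S> \<subseteq> {C \<in> \<A>. diameter C > e / 2}"
    proof
      fix C assume "C \<in> \<S>"
      then obtain C' c where C: "C \<in> \<A>" "w \<in> C" "moves f C C' c w" by (auto simp: \<S>_def)
      have "c \<in> C" using C(3) by (auto simp: moves_def)
      have CX: "C \<subseteq> X" using member_subset[OF C(1)] .
      have "c \<notin> W0" using W0 repeller_not_regular[OF C(3,1)] by (auto simp: regular_def)
      then have "dist w c \<ge> e" using e(2) CX \<open>c \<in> C\<close> by force
      moreover have "bounded C" using CX compact_X by (meson bounded_subset compact_imp_bounded)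
      then have "dist w c \<le> diameter C" using C(2) \<open>c \<in> C\<close> diameter_bounded_bound by blast
      ultimately show "C \<in> {C \<in> \<A>. diameter C > e / 2}" using C(1) e(1) by auto
    qed
    then have finS: "finite \<S>" using null[of "e/2"] e(1) finite_subset by auto
    have "\<forall>C\<in>\<S>. \<exists>y. moves f C (fst y) (snd y) w" by (auto simp: \<S>_def)
    then obtain y where y: "\<forall>C\<in>\<S>. moves f C (fst (y C)) (snd (y C)) w" by (rule bchoice[elim_format]) blast
    define im where "im C = fst (y C)" for C
    define sr where "sr C = snd (y C)" for C
    have mv: "moves f C (im C) (sr C) w" if "C \<in> \<S>" for C using y that by (simp add: im_def sr_def)
    have SA: "C \<in> \<A>" if "C \<in> \<S>" for C using that by (simp add: \<S>_def)
    have uniq: "im C = C'" "sr C = c" if "C \<in> \<S>" "moves f C C' c p" for C C' c p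
      using moves_unique[OF mv[OF that(1)] that(2) SA[OF that(1)]] by auto
    have AS: "A \<in> \<S>" and BS: "B \<in> \<S>" using mA mB A B wA wB w' by (auto simp: \<S>_def)
    have imA: "im A = A" "sr A = n" and imB: "im B = B" "sr B = m"
      using uniq[OF AS mA] uniq[OF BS mB] by auto
    \<comment> \<open>Under the inverse maps, a common point other than \<open>w\<close> would tend
      to both repellers.\<close>
    have meet: "z = w" if "C \<in> \<S>" "D \<in> \<S>" "sr C \<noteq> sr D" "z \<in> im C" "z \<in> im D" for C D z
    proof (rule ccontr)
      assume "z \<noteq> w"
      then have "sr C = sr D"
        using moves_tendsto_inverse[OF mv SA] that LIMSEQ_unique by metis
      then show False using that(3) by blast
    qed
    have imA_member: "im C \<in> \<A>" if "C \<in> \<S>" for C using moves_member[OF mv SA] that by blast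
    define \<S>2 where "\<S>2 = {C \<in> \<S>. sr C \<noteq> n}"
    have finS2: "finite \<S>2" using finS by (simp add: \<S>2_def)
    have S2S: "C \<in> \<S>" "sr C \<noteq> n" if "C \<in> \<S>2" for C using that by (auto simp: \<S>2_def)
    have BS2: "B \<in> \<S>2" using BS imB mn by (simp add: \<S>2_def)
    define M where "M = (\<Union>C\<in>\<S>2. im C)"
    have closedM: "closed M"
      unfolding M_def using finS2 closed_member[OF imA_member[OF S2S(1)]] by (intro closed_UN) auto
    have wM: "w \<in> M" using BS2 imB wB by (auto simp: M_def)
    have srX: "sr C \<in> X" if "C \<in> \<S>" for C
      using mv[OF that] member_subset[OF SA[OF that]] by (auto simp: moves_def)
    have "\<forall>C\<in>\<S>2. \<exists>\<R>. finite \<R> \<and> \<R> \<subseteq> \<A> \<and> separates X (\<Union>\<R>) n (sr C)"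
      using fine[OF wX(2) srX[OF S2S(1)]] S2S(2) by metis
    then obtain \<R> where R: "\<forall>C\<in>\<S>2. finite (\<R> C) \<and> \<R> C \<subseteq> \<A> \<and> separates X (\<Union>(\<R> C)) n (sr C)"
      by (rule bchoice[elim_format]) blast
    obtain Z where Z: "\<And>B. B \<in> \<A> \<Longrightarrow> lims f B (Z B)" using lims_choice[OF order_refl] by blast
    \<comment> \<open>The limits of separator members that miss \<open>w\<close> have a closed
      union, so \<open>W\<close> can be chosen away from them. Any limit of a separator member that
      meets \<open>W\<close> must then contain \<open>w\<close>.\<close>
    define Y where "Y = (\<Union>C\<in>\<S>2. \<Union>D\<in>{D\<in>\<R> C. w \<notin> Z D}. Z D)"
    have "closed Y"
      unfolding Y_def using finS2 R lims_closed[OF Z] by (intro closed_UN ballI) auto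
    then have "openin (top_of_set X) (X - Y)" by (metis Diff_eq open_Compl openin_open_Int)
    moreover have "w \<in> X - Y" using wX by (auto simp: Y_def)
    ultimately obtain W where W: "openin (top_of_set X) W" "connected W" "w \<in> W" "W \<subseteq> X - Y"
      using locally_connected_X unfolding locally_connected by meson
    obtain T where T: "open T" "W = X \<inter> T" using W(1) by (auto simp: openin_open)
    have wT: "w \<in> T" using T W(3) by blast
    have Ww: "connected (W - {w})" by (rule no_local_cut_point[OF W(1-3)])
    obtain a where "a \<in> A" "a \<in> T" and aw: "a \<noteq> w"
      using connected_infinite_accumulates[OF connected_member[OF A] infinite_member[OF A] wA(1) T(1) wT] by blast
    then have aA: "a \<in> A" and aW: "a \<in> W" using T member_subset[OF A] by auto
    have aM: "a \<notin> M"
    proof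
      assume "a \<in> M"
      then obtain C where "C \<in> \<S>2" "a \<in> im C" by (auto simp: M_def)
      then show False using meet[OF AS, of C a] S2S imA aA aw by metis
    qed
    obtain b0 where "b0 \<in> B" "b0 \<in> T" "b0 \<noteq> w"
      using connected_infinite_accumulates[OF connected_member[OF B] infinite_member[OF B] wB T(1) wT] by blast
    then have b0: "b0 \<in> W - {w}" "b0 \<in> M" using T member_subset[OF B] BS2 imB by (auto simp: M_def)
    define U where "U = connected_component_set (W - M) a"
    have aU: "a \<in> U" using aW aM by (simp add: U_def)
    have UW: "U \<subseteq> W - M" unfolding U_def by (rule connected_component_subset)
    have "openin (top_of_set X) (W - M)"
      using W(1) closedM by (metis Diff_eq open_Compl openin_Int_open)
    then have Uop: "openin (top_of_set X) U"
      unfolding U_def using aW aM by (intro locally_connected_2[OF locally_connected_X]) auto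
    \<comment> \<open>Otherwise \<open>U\<close> would be closed as well as open in
      \<open>W - {w}\<close>, which is connected because \<open>w\<close> is not a local cut point;
      but \<open>b0\<close> lies there and not in \<open>U\<close>.\<close>
    have "\<exists>b. b \<in> M \<and> b \<in> W \<and> b \<noteq> w \<and> b \<in> closure U"
    proof (rule ccontr)
      assume neg: "\<not> ?thesis"
      have "closedin (top_of_set (W - M)) U" unfolding U_def by (rule closedin_connected_component)
      then obtain F where F: "closed F" "U = (W - M) \<inter> F" by (auto simp: closedin_closed)
      then have "closure U \<subseteq> F" by (metis closure_minimal inf_le2)
      then have "U = (W - {w}) \<inter> closure U"
        using neg F UW wM closure_subset[of U] by blast
      then have "closedin (top_of_set (W - {w})) U" by (metis closed_closure closedin_closed)
      moreover have "openin (top_of_set (W - {w})) U"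
        using Uop UW wM W(4) by (intro openin_subset_trans[OF Uop]) auto
      ultimately have "U = W - {w}" using Ww aU unfolding connected_clopen by blast
      then show False using b0 UW by blast
    qed
    then obtain b where b: "b \<in> M" "b \<in> W" "b \<noteq> w" "b \<in> closure U" by blast
    obtain C where C: "C \<in> \<S>2" "b \<in> im C" using b(1) by (auto simp: M_def)
    \<comment> \<open>A neighbourhood \<open>N\<close> of \<open>b\<close> off this set meets
      \<open>M\<close> only in images containing \<open>b\<close>, and by \<open>meet\<close> these
      belong to members with the same repeller as \<open>C\<close>. A connection of \<open>a\<close>
      with \<open>b\<close> inside \<open>U \<union> N\<close> thus avoids the images with any other
      repeller.\<close>
    define Y' where "Y' = insert w (\<Union>D\<in>{D\<in>\<S>2. b \<notin> im D}. im D)"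
    have "closed Y'"
      unfolding Y'_def using finS2 closed_member[OF imA_member[OF S2S(1)]]
      by (intro closed_insert closed_UN) auto
    then have "openin (top_of_set X) (W - Y')"
      using W(1) by (metis Diff_eq open_Compl openin_Int_open)
    moreover have "b \<in> W - Y'" using b by (auto simp: Y'_def)
    ultimately obtain N where N: "openin (top_of_set X) N" "connected N" "b \<in> N" "N \<subseteq> W - Y'"
      using locally_connected_X unfolding locally_connected by meson
    obtain T' where T': "open T'" "N = X \<inter> T'" using N(1) by (auto simp: openin_open)
    have "U \<inter> T' \<noteq> {}" using b(4) T' N(3) closure_iff_nhds_not_empty[of b U] by blast
    then have "U \<inter> N \<noteq> {}" using T' UW W(4) by blast
    then have con: "connected (U \<union> N)"
      using N(2) unfolding U_def by (intro connected_Un connected_connected_component) auto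
    have opn: "openin (top_of_set X) (U \<union> N)" using Uop N(1) by blast
    have ab: "compact {a, b}" "{a, b} \<subseteq> U \<union> N" using aU N(3) by auto
    obtain K where K: "compact K" "connected K" "{a, b} \<subseteq> K" "K \<subseteq> U \<union> N"
      by (rule compact_connected_between[OF opn con ab])
    have KW: "K \<subseteq> W" and wK: "w \<notin> K" using K(4) UW N(4) wM by (auto simp: Y'_def)
    have RC: "finite (\<R> C)" "\<R> C \<subseteq> \<A>" "separates X (\<Union>(\<R> C)) n (sr C)" using R C(1) by auto
    obtain D where D: "D \<in> \<R> C" "Z D \<inter> K \<noteq> {}"
    proof (rule connected_through_limits[OF RC, of Z A A w a C "im C" w b K])
      show "lims f B (Z B)" if "B \<in> \<R> C" for B using Z RC(2) that by blast
      show "moves f C (im C) (sr C) w" "C \<in> \<A>" using mv SA S2S C(1) by auto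
    qed (use mA A aA aw C b K KW W in auto)
    have wZ: "w \<in> Z D"
    proof (rule ccontr)
      assume "w \<notin> Z D"
      then have "Z D \<subseteq> Y" using C(1) D(1) by (auto simp: Y_def)
      then show False using D(2) KW W(4) by blast
    qed
    have DA: "D \<in> \<A>" using D(1) RC(2) by blast
    from Z[OF DA] consider q where "Z D = {q}" | c p where "moves f D (Z D) c p"
      unfolding lims_def by blast
    then show False
    proof cases
      case 1
      then show False using wZ wK D(2) by auto
    next
      case (2 c p)
      have wD: "w \<in> D" using fixed_point_in_member[OF 2 DA wZ fp wX(1)] .
      have "p = w" using src(2)[OF 2 DA wD] .
      then have DS: "D \<in> \<S>" using 2 DA wD by (auto simp: \<S>_def)
      have imD: "im D = Z D" "sr D = c" using uniq[OF DS 2] by auto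
      \<comment> \<open>\<open>D\<close> belongs to a separator of \<open>n\<close> and
        \<open>sr C\<close>, so its repeller is neither of them. Hence its image is part of
        \<open>M\<close>, which misses \<open>U\<close>, and it meets \<open>im C\<close> at most in
        \<open>w\<close>, so it does not contain \<open>b\<close> and misses
        \<open>N\<close>.\<close>
      have "c \<in> D" using 2 by (auto simp: moves_def)
      then have c: "c \<noteq> n" "c \<noteq> sr C" using RC(3) D(1) by (auto simp: separates_def)
      have DS2: "D \<in> \<S>2" using DS imD c by (simp add: \<S>2_def)
      have "b \<notin> im D" using meet[OF DS S2S(1)[OF C(1)], of b] c imD C(2) b(3) by auto
      then have "Z D \<inter> N = {}" using N(4) DS2 imD by (auto simp: Y'_def)
      moreover have "Z D \<inter> U = {}" using UW DS2 imD by (auto simp: M_def)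
      ultimately show False using D(2) K(4) by blast
    qed
  qed
qed

text \<open>A fixed point in a member can only be its repeller or its attractor. If these differ in
  one of the two members, \<open>sink_unique\<close> applies there, to \<open>f\<close> when
  \<open>x\<close> is the attractor and to \<open>f'\<close> when it is the repeller; otherwise all
  four points equal \<open>x\<close>.\<close>

lemma touching_fixed:
  assumes mA: "moves f A A n p" and A: "A \<in> \<A>" and mB: "moves f B B m q" and B: "B \<in> \<A>"
    and x: "x \<in> A" "x \<in> B" and fp: "\<And>i. f i x = x"
  shows "n = m \<and> p = q"
proof -
  interpret inv: good_sequence X \<A> f' f by (rule good_sequence_inverse)
  have xX: "x \<in> X" using x member_subset[OF A] by blast
  have fp': "f' i x = x" for i using inv_left[OF xX, of i] fp[of i] by simp
  have iA: "moves f' A A p n" and iB: "moves f' B B q m"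
    using moves_inverse mA mB A B by auto
  have "x = n \<or> x = p" using moves_attractor_fixed[OF mA x(1) _ fp] by auto
  moreover have "x = m \<or> x = q" using moves_attractor_fixed[OF mB x(2) _ fp] by auto
  ultimately consider "p = x" "n \<noteq> x" | "q = x" "m \<noteq> x" | "n = x" "p \<noteq> x" | "m = x" "q \<noteq> x"
    | "n = x" "p = x" "m = x" "q = x"
    by blast
  then show ?thesis
  proof cases
    case 1
    then show ?thesis using sink_unique[of A n x B m q] mA A mB B x(2) fp by auto
  next
    case 2
    then show ?thesis using sink_unique[of B m x A n p] mA A mB B x(1) fp by auto
  next
    case 3
    then show ?thesis using inv.sink_unique[of A p x B q m] iA A iB B x(2) fp' by auto
  next
    case 4
    then show ?thesis using inv.sink_unique[of B q x A p n] iA A iB B x(1) fp' by auto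
  qed auto
qed

text \<open>Composing with the inverse of one map brings an eventual image \<open>A'\<close> back to
  \<open>A\<close>, and fixes every point where \<open>f (r i)\<close> and \<open>f j\<close>
  agree.\<close>

lemma normalized:
  assumes "strict_mono r"
  shows "good_sequence X \<A> (\<lambda>i. f' j \<circ> f (r i)) (\<lambda>i. f' (r i) \<circ> f j)"
proof -
  have h: "homeos (\<lambda>i. f (r i)) (\<lambda>i. f' (r i))" "homeos (\<lambda>i. f' (r i)) (\<lambda>i. f (r i))"
    using homeos unfolding homeos_def by (auto intro: homeomorphism_symD)
  have k: "homeomorphism X X (f' j) (f j)" "homeomorphism X X (f j) (f' j)"
    using homeo homeomorphism_symD by blast+
  have "homeos f' f" using good_sequence.homeos[OF good_sequence_inverse] .
  then have sub: "focusing (\<lambda>i. f (r i))" "focusing (\<lambda>i. f' (r i))"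
    "dichotomy (\<lambda>i. f (r i))" "dichotomy (\<lambda>i. f' (r i))"
    using focusing_subseq[OF homeos dichotomy assms focusing]
      focusing_subseq[OF _ dichotomy_inverse assms focusing_inverse]
      dichotomy_subseq[OF dichotomy assms] dichotomy_subseq[OF dichotomy_inverse assms] by auto
  show ?thesis
  proof unfold_locales
    show "homeos (\<lambda>i. f' j \<circ> f (r i)) (\<lambda>i. f' (r i) \<circ> f j)"
      unfolding homeos_def
    proof (intro allI conjI ballI)
      show "homeomorphism X X (f' j \<circ> f (r i)) (f' (r i) \<circ> f j)" for i
        using homeomorphism_compose[OF homeo k(1)] .
      show "(f' j \<circ> f (r i)) ` A \<in> \<A>" "(f' (r i) \<circ> f j) ` A \<in> \<A>" if "A \<in> \<A>" for A i
        unfolding image_comp[symmetric] using image_member image_inv_member that by blast+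
    qed
    show "dichotomy (\<lambda>i. f' j \<circ> f (r i))" by (rule dichotomy_post[OF k(1) h(1) sub(3)])
    show "dichotomy (\<lambda>i. f' (r i) \<circ> f j)" by (rule dichotomy_pre[OF k(2) image_member sub(4)])
    show "focusing (\<lambda>i. f' j \<circ> f (r i))" by (rule focusing_post[OF k(1) h(1) sub(1)])
    show "focusing (\<lambda>i. f' (r i) \<circ> f j)" by (rule focusing_pre[OF k(2) image_member sub(2)])
  qed
qed

lemma touching:
  assumes mA: "moves f A A' n p" and A: "A \<in> \<A>" and mB: "moves f B B' m q" and B: "B \<in> \<A>"
    and meet: "A \<inter> B \<noteq> {}"
  shows "n = m \<and> p = q"
proof (rule ccontr)
  assume neg: "\<not> ?thesis"
  obtain x where x: "x \<in> A" "x \<in> B" using meet by blast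
  have AX: "A \<subseteq> X" "B \<subseteq> X" using member_subset A B by auto
  have A'X: "A' \<subseteq> X" "B' \<subseteq> X" using member_subset moves_member mA mB A B by auto
  have "\<forall>\<^sub>F i in sequentially. f i ` A = A' \<and> f i ` B = B'"
    using mA mB unfolding moves_def by (auto intro: eventually_conj)
  then obtain i0 where i0: "\<And>i. i \<ge> i0 \<Longrightarrow> f i ` A = A' \<and> f i ` B = B'"
    unfolding eventually_sequentially by blast
  \<comment> \<open>If \<open>p = q\<close>, then \<open>n \<noteq> m\<close>, and a common point
    other than \<open>p\<close> would be pulled back towards both. If \<open>p \<noteq> q\<close>,
    the same argument for \<open>f\<close> confines \<open>A \<inter> B\<close> to
    \<open>{n, m}\<close>, and \<open>A' \<inter> B'\<close> is its image under \<open>f i0\<close>.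
    The pigeonhole principle then makes the images of \<open>x\<close> constant along a
    subsequence.\<close>
  have "finite (A' \<inter> B')"
  proof (cases "p = q")
    case True
    have "A' \<inter> B' \<subseteq> {p}"
    proof
      fix y assume y: "y \<in> A' \<inter> B'"
      show "y \<in> {p}"
      proof (rule ccontr)
        assume "y \<notin> {p}"
        then have "(\<lambda>i. f' i y) \<longlonglongrightarrow> n" "(\<lambda>i. f' i y) \<longlonglongrightarrow> m"
          using moves_tendsto_inverse[OF mA A] moves_tendsto_inverse[OF mB B] y True by auto
        then show False using neg True LIMSEQ_unique by blast
      qed
    qed
    then show ?thesis using finite_subset by blast
  next
    case False
    have "A \<inter> B \<subseteq> {n, m}"
    proof
      fix y assume y: "y \<in> A \<inter> B"
      show "y \<in> {n, m}"
      proof (rule ccontr)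
        assume "y \<notin> {n, m}"
        then have "(\<lambda>i. f i y) \<longlonglongrightarrow> p" "(\<lambda>i. f i y) \<longlonglongrightarrow> q"
          using moves_tendsto[OF mA] moves_tendsto[OF mB] y by auto
        then show False using False LIMSEQ_unique by blast
      qed
    qed
    then have "finite (f i0 ` (A \<inter> B))" using finite_subset by blast
    moreover have "inj_on (f i0) X" using f_eq_iff by (auto simp: inj_on_def)
    then have "f i0 ` (A \<inter> B) = A' \<inter> B'" using i0[of i0] AX inj_on_image_Int by blast
    ultimately show ?thesis by simp
  qed
  moreover have "range (\<lambda>k. f (i0 + k) x) \<subseteq> A' \<inter> B'"
  proof clarify
    fix k
    have "f (i0 + k) ` A = A'" "f (i0 + k) ` B = B'" using i0[of "i0 + k"] by auto
    then show "f (i0 + k) x \<in> A' \<inter> B'" using x by blast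
  qed
  ultimately have "finite (range (\<lambda>k. f (i0 + k) x))" by (rule finite_subset[rotated])
  then obtain k0 where inf: "infinite {k. f (i0 + k) x = f (i0 + k0) x}"
    using pigeonhole_infinite[of UNIV "\<lambda>k. f (i0 + k) x"] by auto
  define r where "r i = i0 + enumerate {k. f (i0 + k) x = f (i0 + k0) x} i" for i
  have r: "strict_mono r"
    using strict_mono_enumerate[OF inf] by (auto simp: r_def strict_mono_def)
  have rx: "f (r i) x = f (i0 + k0) x" for i
    using enumerate_in_set[OF inf, of i] by (simp add: r_def)
  define j where "j = r 0"
  interpret h: good_sequence X \<A> "\<lambda>i. f' j \<circ> f (r i)" "\<lambda>i. f' (r i) \<circ> f j"
    by (rule normalized[OF r])
  have fX: "f (r i) ` X \<subseteq> X" for i using f_in by blast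
  have j0: "f j ` A = A'" "f j ` B = B'" using i0[of j] by (auto simp: j_def r_def)
  then have bk: "f' j ` A' = A" "f' j ` B' = B" using image_image_inv(1) AX by metis+
  have hA: "moves (\<lambda>i. f' j \<circ> f (r i)) A A n (f' j p)"
    using moves_post[OF cont'[of j] fX AX(1) A'X(1) moves_subseq[OF mA r]] bk by simp
  have hB: "moves (\<lambda>i. f' j \<circ> f (r i)) B B m (f' j q)"
    using moves_post[OF cont'[of j] fX AX(2) A'X(2) moves_subseq[OF mB r]] bk by simp
  have "x \<in> X" using x AX by blast
  then have "(f' j \<circ> f (r i)) x = x" for i
    using rx[of i] rx[of 0] inv_left[of x j] by (simp add: j_def)
  then have eq: "n = m \<and> f' j p = f' j q"
    using h.touching_fixed[OF hA A hB B x] by blast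
  have "p \<in> X" "q \<in> X" using mA mB A'X by (auto simp: moves_def)
  then have "p = q" using eq inv_right by metis
  then show False using eq neg by blast
qed

lemma touching_images:
  assumes mA: "moves f A A' n p" and A: "A \<in> \<A>" and mB: "moves f B B' m q" and B: "B \<in> \<A>"
    and meet: "A' \<inter> B' \<noteq> {}"
  shows "n = m \<and> p = q"
proof -
  interpret inv: good_sequence X \<A> f' f by (rule good_sequence_inverse)
  show ?thesis
    using inv.touching[OF moves_inverse[OF mA A] moves_member[OF mA A]
        moves_inverse[OF mB B] moves_member[OF mB B] meet] by blast
qed

end

section \<open>All non-shrinking members have the same repeller and attractor\<close>

context good_sequence
begin

lemma tends_in_X:
  assumes "tends f N q" "N \<subseteq> X" "N \<noteq> {}"
  shows "q \<in> X"
proof -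
  obtain x where x: "x \<in> N" using assms(3) by blast
  have "(\<lambda>i. f i x) \<longlonglongrightarrow> q" using tends_tendsto[OF assms(1) x] .
  moreover have "f i x \<in> X" for i using f_in x assms(2) by blast
  ultimately show ?thesis using closed_X closed_sequentially by metis
qed

text \<open>All limits are single points, and connectedness of the union forces them to coincide, so
  the whole separator shrinks to one point and \<open>focusing\<close> applies.\<close>

lemma shrinking_separator:
  assumes B: "finite \<B>" "\<B> \<subseteq> \<A>" "connected (\<Union>\<B>)" "separates X (\<Union>\<B>) x y"
    and nomove: "\<And>B B' n p. B \<in> \<B> \<Longrightarrow> \<not> moves f B B' n p"
  shows "regular f x \<or> regular f y"
proof -
  have "\<B> \<noteq> {}"
  proof
    assume "\<B> = {}"
    then have "x \<in> X" "y \<in> X" "\<not> connected_component X x y" using B(4) by (auto simp: separates_def)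
    then show False using connected_X connected_iff_connected_component by blast
  qed
  then obtain B0 where B0: "B0 \<in> \<B>" by blast
  obtain Z where Z: "\<And>B. B \<in> \<B> \<Longrightarrow> lims f B (Z B)" using lims_choice[OF B(2)] by blast
  have sing: "\<exists>q. Z B = {q} \<and> tends f B q" if "B \<in> \<B>" for B
    using Z[OF that] nomove[OF that] unfolding lims_def by blast
  obtain q where q: "Z B0 = {q}" "tends f B0 q" using sing[OF B0] by blast
  have "{B\<in>\<B>. Z B = {q}} = \<B>"
  proof (rule lims_connected[OF B(1-3) Z])
    show "{B \<in> \<B>. Z B = {q}} \<noteq> {}" using B0 q by blast
    show "\<Union> (Z ` {B \<in> \<B>. Z B = {q}}) \<inter> \<Union> (Z ` (\<B> - {B \<in> \<B>. Z B = {q}})) = {}"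
      using sing by fastforce
  qed auto
  then have "tends f B q" if "B \<in> \<B>" for B using sing[OF that] that by force
  then have "tends f (\<Union>\<B>) q" by (rule tends_Union[OF B(1)])
  moreover have "q \<in> X"
    using tends_in_X[OF q(2)] B0 B(2) member_subset infinite_member[of B0] by fastforce
  ultimately show ?thesis using focusing B unfolding focusing_def by blast
qed

text \<open>A separator in the image, made of limits with one common type. The attractor
  \<open>p\<close> lies in every element, which makes the union connected; the descent relies on
  this.\<close>

definition separating_class ::
    "'a set \<Rightarrow> 'a set \<Rightarrow> 'a set set \<Rightarrow> 'a \<Rightarrow> 'a \<Rightarrow> bool" where
  "separating_class P Q \<E> n p \<longleftrightarrow> finite \<E> \<and> \<E> \<noteq> {} \<and> (\<forall>E\<in>\<E>. \<exists>B\<in>\<A>. moves f B E n p) \<and>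
     P \<inter> \<Union>\<E> = {} \<and> Q \<inter> \<Union>\<E> = {} \<and> (\<forall>a\<in>P. \<forall>b\<in>Q. \<not> connected_component (X - \<Union>\<E>) a b)"

lemma class_connected:
  assumes "\<forall>E\<in>\<E>. \<exists>B\<in>\<A>. moves f B E n p"
  shows "connected (\<Union>\<E>)" "\<Union>\<E> \<subseteq> X" "\<And>E. E \<in> \<E> \<Longrightarrow> p \<in> E \<and> E \<in> \<A>"
proof -
  show *: "p \<in> E \<and> E \<in> \<A>" if "E \<in> \<E>" for E
  proof -
    obtain B where "B \<in> \<A>" "moves f B E n p" using assms \<open>E \<in> \<E>\<close> by blast
    then show ?thesis using moves_member by (auto simp: moves_def)
  qed
  show "connected (\<Union>\<E>)"
  proof (cases "\<E> = {}")
    case False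
    then show ?thesis using * connected_member by (intro connected_Union) blast+
  qed simp
  show "\<Union>\<E> \<subseteq> X" using * member_subset by blast
qed

text \<open>A connected separator of the two repellers has a non-shrinking member, since repellers
  are not regular. Let \<open>D\<close> be the union of the limits of its type. A limit that meets
  \<open>D\<close> is a point of \<open>D\<close> or, by \<open>touching_images\<close>, has the
  same type, so connectedness puts all limits into \<open>D\<close>. A connection of
  \<open>A1'\<close> with \<open>A2'\<close> off \<open>D\<close> would then contradict
  \<open>connected_through_limits\<close>.\<close>

lemma separating_class_exists:
  assumes m1: "moves f A1 A1' n1 p1" "A1 \<in> \<A>" and m2: "moves f A2 A2' n2 p2" "A2 \<in> \<A>"
    and n12: "n1 \<noteq> n2"
  obtains \<E> n p where "separating_class A1' A2' \<E> n p" "n \<noteq> n1" "n \<noteq> n2"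
proof -
  have nX: "n1 \<in> X" "n2 \<in> X" using m1 m2 member_subset by (auto simp: moves_def)
  obtain \<B> where B: "finite \<B>" "\<B> \<subseteq> \<A>" "connected (\<Union>\<B>)" "separates X (\<Union>\<B>) n1 n2"
    using fine[OF nX n12] by blast
  have notin: "n1 \<notin> \<Union>\<B>" "n2 \<notin> \<Union>\<B>" using B(4) by (auto simp: separates_def)
  obtain Z where Z: "\<And>B. B \<in> \<B> \<Longrightarrow> lims f B (Z B)" using lims_choice[OF B(2)] by blast
  have "\<not> regular f n1" "\<not> regular f n2" using repeller_not_regular m1 m2 by blast+
  then obtain B3 B3' n p where B3: "B3 \<in> \<B>" "moves f B3 B3' n p"
    using shrinking_separator[OF B] by blast
  have BA: "B \<in> \<A>" if "B \<in> \<B>" for B using that B(2) by blast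
  have ZB: "Z B = B'" if mv: "moves f B B' m q" and BB: "B \<in> \<B>" for B B' m q
  proof -
    from Z[OF BB] consider q' where "tends f B q'" | m' q' where "moves f B (Z B) m' q'"
      unfolding lims_def by blast
    then show ?thesis
    proof cases
      case 1
      obtain a where a: "a \<in> B'" "a \<noteq> q'"
        using infinite_avoid2[OF infinite_member[OF moves_member[OF mv BA[OF BB]]]] by metis
      have "\<forall>\<^sub>F i in sequentially. f i ` B = B'" using mv by (simp add: moves_def)
      moreover have "\<forall>\<^sub>F i in sequentially. f i ` B \<subseteq> - {a}" using 1 a unfolding tends_def by auto
      ultimately have "\<forall>\<^sub>F i::nat in sequentially. False"
        by eventually_elim (use a in auto)
      then show ?thesis by simp
    next
      case 2
      then show ?thesis using moves_unique(1)[OF 2 mv BA[OF BB]] by simp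
    qed
  qed
  define \<C> where "\<C> = {B\<in>\<B>. moves f B (Z B) n p}"
  define D where "D = \<Union>(Z ` \<C>)"
  have B3C: "B3 \<in> \<C>" using B3 ZB[OF B3(2,1)] by (auto simp: \<C>_def)
  have absorb: "Z B \<subseteq> D" if BB: "B \<in> \<B>" and ZBD: "Z B \<inter> D \<noteq> {}" for B
  proof -
    from Z[OF BB] consider q' where "Z B = {q'}" | m' q' where "moves f B (Z B) m' q'"
      unfolding lims_def by blast
    then show ?thesis
    proof cases
      case 1
      then show ?thesis using ZBD by auto
    next
      case 2
      obtain C where C: "C \<in> \<B>" "moves f C (Z C) n p" "Z B \<inter> Z C \<noteq> {}"
        using ZBD by (auto simp: D_def \<C>_def)
      have "m' = n \<and> q' = p"
        using touching_images[OF 2 BA[OF BB] C(2) BA[OF C(1)] C(3)] .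
      then have "B \<in> \<C>" using 2 BB by (simp add: \<C>_def)
      then show ?thesis by (auto simp: D_def)
    qed
  qed
  have Zne: "Z B3 \<noteq> {}" using lims_nonempty[OF Z[OF B3(1)]] .
  have "{B\<in>\<B>. Z B \<inter> D \<noteq> {}} = \<B>"
  proof (rule lims_connected[OF B(1-3) Z])
    have "Z B3 \<inter> D \<noteq> {}" using Zne B3C by (auto simp: D_def)
    then show "{B \<in> \<B>. Z B \<inter> D \<noteq> {}} \<noteq> {}" using B3(1) by blast
    have "\<Union> (Z ` {B \<in> \<B>. Z B \<inter> D \<noteq> {}}) \<subseteq> D" using absorb by blast
    moreover have "\<Union> (Z ` (\<B> - {B \<in> \<B>. Z B \<inter> D \<noteq> {}})) \<inter> D = {}" by blast
    ultimately show "\<Union> (Z ` {B \<in> \<B>. Z B \<inter> D \<noteq> {}}) \<inter> \<Union> (Z ` (\<B> - {B \<in> \<B>. Z B \<inter> D \<noteq> {}})) = {}"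
      by blast
  qed auto
  then have ZD: "Z B \<subseteq> D" if "B \<in> \<B>" for B using absorb that by blast
  have "n \<in> B3" using B3(2) by (simp add: moves_def)
  then have n: "n \<noteq> n1" "n \<noteq> n2" using notin B3(1) by auto
  have disj: "A' \<inter> D = {}" if "moves f A A' m q" "A \<in> \<A>" "m \<noteq> n" for A A' m q
  proof (rule ccontr)
    assume "A' \<inter> D \<noteq> {}"
    then obtain C where C: "C \<in> \<B>" "moves f C (Z C) n p" "A' \<inter> Z C \<noteq> {}"
      by (auto simp: D_def \<C>_def)
    then show False using touching_images[OF that(1,2) C(2) BA[OF C(1)] C(3)] that(3) by blast
  qed
  have "\<forall>E\<in>Z ` \<C>. \<exists>B\<in>\<A>. moves f B E n p" using BA by (auto simp: \<C>_def)
  moreover have finE: "finite (Z ` \<C>)" using B(1) by (simp add: \<C>_def)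
  moreover have "closed D"
    unfolding D_def using finE class_connected(3)[OF calculation(1)] closed_member by (intro closed_Union) auto
  moreover have "\<not> connected_component (X - D) a b" if ab: "a \<in> A1'" "b \<in> A2'" for a b
  proof
    assume conn: "connected_component (X - D) a b"
    have A': "A1' \<in> \<A>" "A2' \<in> \<A>" using moves_member m1 m2 by auto
    \<comment> \<open>\<open>connected_through_limits\<close> needs end points other than the
      attractors; the connected sets \<open>A1'\<close> and \<open>A2'\<close> avoid
      \<open>D\<close>, so the ends can be moved within them.\<close>
    obtain a' where a': "a' \<in> A1'" "a' \<noteq> p1" using infinite_avoid2[OF infinite_member[OF A'(1)]] by metis
    obtain b' where b': "b' \<in> A2'" "b' \<noteq> p2" using infinite_avoid2[OF infinite_member[OF A'(2)]] by metis
    have "A1' \<subseteq> X - D" "A2' \<subseteq> X - D"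
      using disj[OF m1] disj[OF m2] n member_subset A' by blast+
    then have "connected_component (X - D) a' a" "connected_component (X - D) b b'"
      using connected_member A' a' b' ab unfolding connected_component_def by blast+
    then have conn': "connected_component (X - D) a' b'"
      using conn connected_component_trans by metis
    let ?U = "connected_component_set (X - D) a'"
    have opU: "openin (top_of_set X) ?U" using \<open>closed D\<close> by (rule openin_component_Diff)
    have conU: "connected ?U" by (rule connected_connected_component)
    have "a' \<in> X - D" using a'(1) \<open>A1' \<subseteq> X - D\<close> by blast
    then have ab': "compact {a', b'}" "{a', b'} \<subseteq> ?U" using conn' by auto
    obtain K where K: "compact K" "connected K" "{a', b'} \<subseteq> K" "K \<subseteq> ?U"
      by (rule compact_connected_between[OF opU conU ab'])
    have KX: "K \<subseteq> X - D" using K(4) connected_component_subset by blast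
    obtain B where B': "B \<in> \<B>" "Z B \<inter> K \<noteq> {}"
    proof (rule connected_through_limits[OF B(1,2,4) Z m1 a' m2 b' K(1,2)])
    qed (use KX K in auto)
    then show False using ZD[OF B'(1)] KX by blast
  qed
  ultimately have "separating_class A1' A2' (Z ` \<C>) n p"
    using disj[OF m1] disj[OF m2] n B3C unfolding separating_class_def D_def by auto
  then show ?thesis using that n by blast
qed

text \<open>The new class arises from \<open>separating_class_exists\<close> for \<open>A1\<close>
  and a member with image in \<E>. Its type differs from that of \<E>, so the two unions are
  disjoint, and as \<open>\<Union>\<E>\<close> is connected the new class cuts all of it off from
  \<open>a\<close>.\<close>

lemma separating_class_step:
  assumes m1: "moves f A1 A1' n1 p1" "A1 \<in> \<A>" and sc: "separating_class A1' Q \<E> n p" and n: "n \<noteq> n1"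
    and a: "a \<in> A1'"
  obtains \<F> m q where "separating_class A1' Q \<F> m q" "m \<noteq> n1"
    "connected_component_set (X - \<Union>\<F>) a \<subseteq> connected_component_set (X - \<Union>\<E>) a"
    "\<Union>\<F> \<subseteq> connected_component_set (X - \<Union>\<E>) a"
proof -
  have E: "finite \<E>" "\<E> \<noteq> {}" "\<forall>E\<in>\<E>. \<exists>B\<in>\<A>. moves f B E n p" "A1' \<inter> \<Union>\<E> = {}"
    "\<And>a b. a \<in> A1' \<Longrightarrow> b \<in> Q \<Longrightarrow> \<not> connected_component (X - \<Union>\<E>) a b"
    using sc by (auto simp: separating_class_def)
  note cE = class_connected[OF E(3)]
  obtain E0 B0 where E0: "E0 \<in> \<E>" "B0 \<in> \<A>" "moves f B0 E0 n p" using E by blast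
  obtain \<F> m q where F: "separating_class A1' E0 \<F> m q" "m \<noteq> n1" "m \<noteq> n"
    using separating_class_exists[OF m1 E0(3,2)] n by metis
  have F': "finite \<F>" "\<F> \<noteq> {}" "\<forall>E\<in>\<F>. \<exists>B\<in>\<A>. moves f B E m q" "A1' \<inter> \<Union>\<F> = {}"
    "\<And>a b. a \<in> A1' \<Longrightarrow> b \<in> E0 \<Longrightarrow> \<not> connected_component (X - \<Union>\<F>) a b"
    using F(1) by (auto simp: separating_class_def)
  note cF = class_connected[OF F'(3)]
  have A1': "A1' \<in> \<A>" using moves_member m1 by blast
  have aX: "a \<in> X" using a member_subset[OF A1'] by blast
  have disj: "\<Union>\<E> \<inter> \<Union>\<F> = {}"
  proof (rule ccontr)
    assume "\<Union>\<E> \<inter> \<Union>\<F> \<noteq> {}"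
    then obtain E F where EF: "E \<in> \<E>" "F \<in> \<F>" "E \<inter> F \<noteq> {}" by blast
    obtain B where B: "B \<in> \<A>" "moves f B E n p" using E(3) EF(1) by blast
    obtain C where C: "C \<in> \<A>" "moves f C F m q" using F'(3) EF(2) by blast
    show False using touching_images[OF B(2,1) C(2,1) EF(3)] F(3) by blast
  qed
  have sepE: "\<not> connected_component (X - \<Union>\<F>) a z" if "z \<in> \<Union>\<E>" for z
  proof
    assume *: "connected_component (X - \<Union>\<F>) a z"
    have "\<Union>\<E> \<subseteq> X - \<Union>\<F>" using disj cE(2) by blast
    moreover obtain e where "e \<in> E0" using cE(3)[OF E0(1)] by blast
    moreover then have "e \<in> \<Union>\<E>" using E0(1) by blast
    ultimately have "connected_component (X - \<Union>\<F>) z e" "e \<in> E0"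
      using cE(1) that unfolding connected_component_def by blast+
    then show False using * F'(5)[OF a] connected_component_trans by metis
  qed
  let ?V = "connected_component_set (X - \<Union>\<E>) a" and ?V2 = "connected_component_set (X - \<Union>\<F>) a"
  have aE: "a \<in> X - \<Union>\<E>" using a aX E(4) by blast
  have aF: "a \<in> X - \<Union>\<F>" using a aX F'(4) by blast
  have aV: "a \<in> ?V" "a \<in> ?V2" using aE aF by auto
  have V2: "?V2 \<subseteq> X - \<Union>\<F>" "?V \<subseteq> X - \<Union>\<E>" by (rule connected_component_subset)+
  have "?V2 \<subseteq> X - \<Union>\<E>" using V2(1) sepE by blast
  then have sub: "?V2 \<subseteq> ?V"
    using aV(2) by (intro connected_component_maximal) auto
  have clE: "closed (\<Union>\<E>)" using E(1) cE(3) closed_member by (intro closed_Union) auto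
  \<comment> \<open>Otherwise \<open>?V\<close>, whose closure reaches \<open>\<Union>\<E>\<close>
    because \<open>X\<close> is connected, would join \<open>a\<close> to
    \<open>\<Union>\<E>\<close> off \<open>\<Union>\<F>\<close>.\<close>
  have "\<Union>\<F> \<inter> ?V \<noteq> {}"
  proof
    assume FV: "\<Union>\<F> \<inter> ?V = {}"
    have "closure ?V \<inter> \<Union>\<E> \<noteq> {}"
    proof
      assume neg: "closure ?V \<inter> \<Union>\<E> = {}"
      have "closedin (top_of_set (X - \<Union>\<E>)) ?V" by (rule closedin_connected_component)
      then obtain T where T: "closed T" "?V = (X - \<Union>\<E>) \<inter> T" by (auto simp: closedin_closed)
      have "closure ?V \<subseteq> T" using T by (metis closure_minimal inf_le2)
      moreover have "closure ?V \<subseteq> X" using V2(2) closed_X by (meson Diff_subset closure_minimal order_trans)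
      ultimately have "closure ?V \<subseteq> ?V" using T(2) neg by blast
      then have "closed ?V" by (metis closure_subset closure_eq order_antisym)
      then have "closedin (top_of_set X) ?V" using V2(2) by (intro closed_subset) auto
      moreover have "openin (top_of_set X) ?V" using clE by (rule openin_component_Diff)
      ultimately have "?V = X" using connected_X aV(1) unfolding connected_clopen by blast
      then show False using V2(2) cE(2,3) E(2) by blast
    qed
    then obtain b where b: "b \<in> closure ?V" "b \<in> \<Union>\<E>" by blast
    have "?V \<subseteq> insert b ?V" "insert b ?V \<subseteq> closure ?V" using b(1) closure_subset[of ?V] by auto
    then have "connected (insert b ?V)"
      using connected_intermediate_closure connected_connected_component by metis
    moreover have "insert b ?V \<subseteq> X - \<Union>\<F>" using FV V2(2) b(2) disj cE(2) by blast
    ultimately have "connected_component (X - \<Union>\<F>) a b"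
      using aV(1) unfolding connected_component_def by blast
    then show False using sepE b(2) by blast
  qed
  then obtain z where z: "z \<in> \<Union>\<F>" "z \<in> ?V" by blast
  have "\<Union>\<F> \<subseteq> X - \<Union>\<E>" using disj cF(2) by blast
  then have "\<Union>\<F> \<subseteq> connected_component_set (X - \<Union>\<E>) z"
    using z(1) cF(1) by (intro connected_component_maximal)
  also have "\<dots> = ?V" using z(2) connected_component_eq by metis
  finally have FV: "\<Union>\<F> \<subseteq> ?V" .
  have VQ: "?V \<inter> Q = {}" using E(5)[OF a] by auto
  have "\<not> connected_component (X - \<Union>\<F>) a1 b" if "a1 \<in> A1'" "b \<in> Q" for a1 b
  proof
    assume *: "connected_component (X - \<Union>\<F>) a1 b"
    have "A1' \<subseteq> X - \<Union>\<F>" using F'(4) member_subset[OF A1'] by blast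
    then have "connected_component (X - \<Union>\<F>) a a1"
      using connected_member[OF A1'] a that(1) unfolding connected_component_def by blast
    then have "b \<in> ?V2" using * connected_component_trans by (metis mem_Collect_eq)
    then show False using sub VQ that(2) by blast
  qed
  then have "separating_class A1' Q \<F> m q"
    using F' FV VQ unfolding separating_class_def by blast
  then show ?thesis using that F(2) sub FV by blast
qed

text \<open>Otherwise there is an infinite descent: each separating class yields another one that is
  closer to \<open>A1'\<close>, and all of them contain a member of diameter larger than a fixed \<open>d\<close>.\<close>

lemma single_type:
  assumes m1: "moves f A1 A1' n1 p1" "A1 \<in> \<A>" and m2: "moves f A2 A2' n2 p2" "A2 \<in> \<A>"
  shows "n1 = n2 \<and> p1 = p2"
proof (cases "n1 = n2")
  case True
  then have "n1 \<in> A1 \<inter> A2" using m1 m2 by (auto simp: moves_def)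
  then show ?thesis using touching[OF m1 m2] by blast
next
  case False
  have A': "A1' \<in> \<A>" "A2' \<in> \<A>" using moves_member m1 m2 by auto
  obtain a where a: "a \<in> A1'" using m1 by (auto simp: moves_def)
  obtain d where d: "d > 0"
    "\<And>S q. \<lbrakk>q \<in> X; S \<subseteq> cball q d\<rbrakk> \<Longrightarrow> \<exists>a\<in>A1'. \<exists>b\<in>A2'. connected_component (X - S) a b"
    using small_set_does_not_separate_sets[of A1' A2'] member_subset infinite_member A' by metis
  \<comment> \<open>The cardinality of this set is the measure of the descent. By the choice of
    \<open>d\<close>, some \<open>L\<close> in the next class reaches farther than \<open>d\<close>
    from the common attractor; it lies in the old component of \<open>a\<close> but, as part of the
    new separator, not in the new one.\<close>
  define large where "large \<E> = {L \<in> \<A>. diameter L > d \<and> L \<subseteq> connected_component_set (X - \<Union>\<E>) a}" for \<E>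
  have fin: "finite (large \<E>)" for \<E>
    using null[OF d(1)] by (rule finite_subset[rotated]) (auto simp: large_def)
  have "False" if "separating_class A1' A2' \<E> n p" "n \<noteq> n1" for \<E> n p
    using that
  proof (induction "card (large \<E>)" arbitrary: \<E> n p rule: less_induct)
    case less
    obtain \<F> m q where F: "separating_class A1' A2' \<F> m q" "m \<noteq> n1"
      "connected_component_set (X - \<Union>\<F>) a \<subseteq> connected_component_set (X - \<Union>\<E>) a"
      "\<Union>\<F> \<subseteq> connected_component_set (X - \<Union>\<E>) a"
      by (rule separating_class_step[OF m1 less.prems a])
    have F': "\<F> \<noteq> {}" "\<forall>E\<in>\<F>. \<exists>B\<in>\<A>. moves f B E m q"
      "\<And>a b. a \<in> A1' \<Longrightarrow> b \<in> A2' \<Longrightarrow> \<not> connected_component (X - \<Union>\<F>) a b"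
      using F(1) by (auto simp: separating_class_def)
    note cF = class_connected[OF F'(2)]
    have "q \<in> X" using cF(2,3) F'(1) by blast
    then have "\<not> \<Union>\<F> \<subseteq> cball q d" using d(2) F'(3) by blast
    then obtain L z where L: "L \<in> \<F>" "z \<in> L" "z \<notin> cball q d" by blast
    have LA: "L \<in> \<A>" "q \<in> L" using cF(3)[OF L(1)] by auto
    have "bounded L" using member_subset[OF LA(1)] compact_X by (meson bounded_subset compact_imp_bounded)
    then have "dist q z \<le> diameter L" using LA(2) L(2) diameter_bounded_bound by blast
    then have "diameter L > d" using L(3) by simp
    then have "L \<in> large \<E>" using LA L(1) F(4) by (auto simp: large_def)
    moreover have "L \<notin> large \<F>"
      using L(1,2) connected_component_subset[of "X - \<Union>\<F>" a] unfolding large_def by blast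
    moreover have "large \<F> \<subseteq> large \<E>" using F(3) unfolding large_def by blast
    ultimately have "card (large \<F>) < card (large \<E>)"
      using fin by (intro psubset_card_mono) auto
    then show False using less.hyps F(1,2) by blast
  qed
  moreover obtain \<E> n p where "separating_class A1' A2' \<E> n p" "n \<noteq> n1" "n \<noteq> n2"
    by (rule separating_class_exists[OF m1 m2 False])
  ultimately show ?thesis by blast
qed

text \<open>If some member moves, then by \<open>single_type\<close> all moving members contain the
  common repeller \<open>n\<close>, so a separator of \<open>x\<close> from \<open>n\<close> has
  only shrinking members, and \<open>n\<close> is irregular. If none moves, any two points include a
  regular one.\<close>

lemma one_irregular_point:
  assumes "X \<noteq> {}"
  obtains n where "n \<in> X" "\<And>x. x \<in> X \<Longrightarrow> x \<noteq> n \<Longrightarrow> regular f x"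
proof (cases "\<exists>A\<in>\<A>. \<exists>A' n p. moves f A A' n p")
  case True
  then obtain A A' n p where A: "A \<in> \<A>" "moves f A A' n p" by blast
  have nX: "n \<in> X" using A member_subset by (auto simp: moves_def)
  have "regular f x" if x: "x \<in> X" "x \<noteq> n" for x
  proof -
    obtain \<B> where B: "finite \<B>" "\<B> \<subseteq> \<A>" "connected (\<Union>\<B>)" "separates X (\<Union>\<B>) x n"
      using fine[OF x(1) nX x(2)] by blast
    have "\<not> moves f B B' m q" if "B \<in> \<B>" for B B' m q
    proof
      assume mv: "moves f B B' m q"
      then have "m = n" using single_type[OF mv _ A(2,1)] B(2) that by blast
      then have "n \<in> \<Union>\<B>" using mv that by (auto simp: moves_def)
      then show False using B(4) by (auto simp: separates_def)
    qed
    then have "regular f x \<or> regular f n" by (rule shrinking_separator[OF B])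
    then show ?thesis using repeller_not_regular[OF A(2,1)] by blast
  qed
  then show ?thesis using that nX by blast
next
  case False
  have one: "regular f x \<or> regular f y" if xy: "x \<in> X" "y \<in> X" "x \<noteq> y" for x y
  proof -
    obtain \<B> where B: "finite \<B>" "\<B> \<subseteq> \<A>" "connected (\<Union>\<B>)" "separates X (\<Union>\<B>) x y"
      using fine[OF xy] by blast
    then show ?thesis using False by (intro shrinking_separator[OF B]) blast
  qed
  show ?thesis
  proof (cases "\<exists>n\<in>X. \<not> regular f n")
    case True
    then show ?thesis using that one by blast
  next
    case False
    then show ?thesis using that assms by blast
  qed
qed

lemma converges:
  assumes "X \<noteq> {}"
  obtains n p where "n \<in> X" "p \<in> X" "\<And>C. compact C \<Longrightarrow> C \<subseteq> X \<Longrightarrow> n \<notin> C \<Longrightarrow> tends f C p"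
proof -
  obtain n where n: "n \<in> X" "\<And>x. x \<in> X \<Longrightarrow> x \<noteq> n \<Longrightarrow> regular f x"
    using one_irregular_point[OF assms] by blast
  show ?thesis
  proof (cases "X = {n}")
    case True
    have "tends f C n" if "C \<subseteq> X" "n \<notin> C" for C
    proof -
      have "C = {}" using that True by auto
      then show ?thesis by (simp add: tends_def)
    qed
    then show ?thesis using that n(1) by blast
  next
    case False
    then obtain x0 where x0: "x0 \<in> X" "x0 \<noteq> n" using n(1) by blast
    obtain N0 p where N0: "x0 \<in> N0" "p \<in> X" "tends f N0 p"
      using n(2)[OF x0] by (auto simp: regular_def)
    have x0p: "(\<lambda>i. f i x0) \<longlonglongrightarrow> p" by (rule tends_tendsto[OF N0(3,1)])
    have lim: "(\<lambda>i. f i x) \<longlonglongrightarrow> p" if x: "x \<in> X - {n}" for x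
    proof -
      \<comment> \<open>Having the same limits is an equivalence relation, and regularity makes its
        classes open in \<open>X - {n}\<close>.\<close>
      define R where "R x y \<longleftrightarrow> (\<forall>q. (\<lambda>i. f i x) \<longlonglongrightarrow> q \<longleftrightarrow> (\<lambda>i. f i y) \<longlonglongrightarrow> q)" for x y
      have "R x0 x"
      proof (rule connected_equivalence_relation[OF no_cut_point[OF n(1)]])
        fix a assume a: "a \<in> X - {n}"
        then obtain N q where N: "openin (top_of_set X) N" "a \<in> N" "tends f N q"
          using n(2)[of a] unfolding regular_def by blast
        have "R a y" if "y \<in> N" for y
          unfolding R_def
          using tends_tendsto[OF N(3) N(2)] tends_tendsto[OF N(3) that] LIMSEQ_unique by blast
        moreover have "openin (top_of_set (X - {n})) ((X - {n}) \<inter> N)"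
          using N(1) by (auto simp: openin_open)
        ultimately show "\<exists>T. openin (top_of_set (X - {n})) T \<and> a \<in> T \<and> (\<forall>x\<in>T. R a x)"
          using a N(2) by blast
      qed (use x0 x in \<open>auto simp: R_def\<close>)
      then show ?thesis using x0p by (simp add: R_def)
    qed
    have "tends f C p" if C: "compact C" "C \<subseteq> X" "n \<notin> C" for C
    proof -
      have "\<forall>x\<in>C. \<exists>T. open T \<and> x \<in> T \<and> tends f (X \<inter> T) p"
      proof
        fix x assume x: "x \<in> C"
        then have xX: "x \<in> X" "x \<noteq> n" using C by auto
        then obtain N q where N: "openin (top_of_set X) N" "x \<in> N" "tends f N q"
          using n(2)[of x] unfolding regular_def by blast
        have "q = p" using tends_tendsto[OF N(3,2)] lim xX LIMSEQ_unique by blast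
        then show "\<exists>T. open T \<and> x \<in> T \<and> tends f (X \<inter> T) p"
          using N by (auto simp: openin_open)
      qed
      then obtain T where T: "\<forall>x\<in>C. open (T x) \<and> x \<in> T x \<and> tends f (X \<inter> T x) p"
        by (rule bchoice[elim_format]) blast
      then have "open (T c)" if "c \<in> C" for c using that by blast
      moreover have "C \<subseteq> (\<Union>c\<in>C. T c)" using T by blast
      ultimately obtain D where D: "D \<subseteq> C" "finite D" "C \<subseteq> (\<Union>c\<in>D. T c)"
        by (rule compactE_image[OF C(1)])
      have "tends f (\<Union>((\<lambda>c. X \<inter> T c) ` D)) p"
        using D T by (intro tends_Union) auto
      moreover have "C \<subseteq> \<Union>((\<lambda>c. X \<inter> T c) ` D)" using C(2) D(3) by auto
      ultimately show ?thesis by (rule tends_mono)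
    qed
    then show ?thesis using that n(1) N0(2) by blast
  qed
qed

end

section \<open>Passing to good subsequences\<close>

text \<open>For each \<open>k\<close> the diagonal sequence is a subsequence of the
  \<open>k\<close>-th selection only after finitely many terms. Hence \<open>Q\<close> must pass to
  subsequences and must not depend on an initial segment.\<close>

lemma diagonal_subsequence:
  fixes g :: "nat \<Rightarrow> 'b"
  assumes "countable I"
    and ex: "\<And>k (s::nat \<Rightarrow> nat). \<lbrakk>k \<in> I; strict_mono s\<rbrakk> \<Longrightarrow>
      \<exists>r::nat \<Rightarrow> nat. strict_mono r \<and> Q k (\<lambda>i. g (s (r i)))"
    and sub: "\<And>k h (r::nat \<Rightarrow> nat). strict_mono r \<Longrightarrow> Q k h \<Longrightarrow> Q k (\<lambda>i. h (r i))"
    and tail: "\<And>k h m. Q k (\<lambda>i. h (i + m)) \<Longrightarrow> Q k h"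
  obtains r :: "nat \<Rightarrow> nat" where "strict_mono r" "\<And>k. k \<in> I \<Longrightarrow> Q k (\<lambda>i. g (r i))"
proof (cases "I = {}")
  case True
  then show ?thesis using that[of id] by (simp add: strict_mono_def)
next
  case False
  interpret subseqs "\<lambda>k s. Q (from_nat_into I k) (\<lambda>i. g (s i))"
    using ex from_nat_into[OF False] by unfold_locales (auto simp: o_def)
  have "Q (from_nat_into I k) (\<lambda>i. g (diagseq i))" for k
  proof (rule tail[where m="Suc k"])
    have "Q (from_nat_into I k) (\<lambda>i. g ((diagseq \<circ> (+) (Suc k)) i))"
      by (rule diagseq_holds) (use sub in \<open>auto simp: o_def\<close>)
    then show "Q (from_nat_into I k) (\<lambda>i. g (diagseq (i + Suc k)))" by (simp add: add.commute[of k])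
  qed
  then have "Q k (\<lambda>i. g (diagseq i))" if "k \<in> I" for k
    using from_nat_into_surj[OF assms(1) that] by metis
  then show ?thesis using that subseq_diagseq by blast
qed

lemma tends_tail: "tends (\<lambda>i. f (i + m)) N q \<Longrightarrow> tends f N q"
  unfolding tends_def using eventually_sequentially_seg by blast

lemma moves_tail:
  assumes "moves (\<lambda>i. f (i + m)) A A' n p"
  shows "moves f A A' n p"
  using assms unfolding moves_def
    eventually_sequentially_seg[where P="\<lambda>i. f i ` A = A'"]
    eventually_sequentially_seg[where P="\<lambda>i. f i ` (A - V) \<subseteq> U" for U V] .

lemma moves_cong:
  assumes "\<And>i x. x \<in> A \<Longrightarrow> f i x = g i x"
  shows "moves f A A' n p \<longleftrightarrow> moves g A A' n p"
proof -
  have "f i ` A = g i ` A" "f i ` (A - V) = g i ` (A - V)" for i V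
    using assms by (auto intro!: image_cong)
  then show ?thesis unfolding moves_def by simp
qed

lemma eventually_choose_subseq:
  assumes "\<And>n. \<forall>\<^sub>F i in sequentially. P n i"
  obtains r :: "nat \<Rightarrow> nat" where "strict_mono r" "\<And>n. P n (r n)"
proof -
  have ex: "\<exists>i>m. P n i" for n m
  proof -
    obtain N where "\<forall>i\<ge>N. P n i" using assms[of n] unfolding eventually_sequentially by blast
    then have "P n (max N (Suc m))" "max N (Suc m) > m" by auto
    then show ?thesis by blast
  qed
  have "\<exists>r. \<forall>n. P n (r n) \<and> r n < r (Suc n)"
    using ex by (intro dependent_nat_choice) blast+
  then show ?thesis using that by (auto simp: strict_mono_Suc_iff)
qed

context fine_family
begin

lemma countable_members: "countable \<A>"
proof -
  have "\<A> \<subseteq> (\<Union>n. {A \<in> \<A>. diameter A > inverse (real (Suc n))})"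
  proof
    fix A assume A: "A \<in> \<A>"
    obtain a where a: "a \<in> A" using infinite_member[OF A] by fastforce
    obtain b where b: "b \<in> A" "b \<noteq> a" using infinite_avoid2[OF infinite_member[OF A]] by metis
    have "bounded A" using member_subset[OF A] compact_X by (meson bounded_subset compact_imp_bounded)
    then have "dist a b \<le> diameter A" using a b diameter_bounded_bound by blast
    then have "diameter A > 0" using b(2) by (metis dist_pos_lt less_le_trans)
    then show "A \<in> (\<Union>n. {A \<in> \<A>. diameter A > inverse (real (Suc n))})"
      using A reals_Archimedean by blast
  qed
  moreover have "finite {A \<in> \<A>. diameter A > inverse (real (Suc n))}" for n
    by (rule null) simp
  ultimately show ?thesis
    by (meson countable_UN countable_finite countable_subset countableI_type)
qed

text \<open>The image of \<open>R\<close> is brought so close to \<open>q\<close> that the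
  complement of a small ball around \<open>q\<close> lies in one component of the complement of that
  image. Pulled back, at most one component of \<open>X - R\<close> fails to be mapped into the
  ball.\<close>

lemma focusing_subsequence_single:
  assumes f: "homeos f f'" and R: "closed R" "R \<subseteq> X" and q: "q \<in> X" and t: "tends f R q"
  obtains r where "strict_mono r" "\<And>x y. separates X R x y \<Longrightarrow> regular (\<lambda>i. f (r i)) x \<or> regular (\<lambda>i. f (r i)) y"
proof -
  let ?e = "\<lambda>n. inverse (real (Suc n))"
  have "\<forall>n. \<exists>d>0. \<forall>S x y. S \<subseteq> cball q d \<longrightarrow> x \<in> X - ball q (?e n) \<longrightarrow> y \<in> X - ball q (?e n) \<longrightarrow>
      connected_component (X - S) x y"
    using small_set_does_not_separate[OF q] by (metis inverse_positive_iff_positive of_nat_0_less_iff zero_less_Suc)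
  then obtain d where d: "\<And>n. d n > 0"
    "\<And>n S x y. \<lbrakk>S \<subseteq> cball q (d n); x \<in> X - ball q (?e n); y \<in> X - ball q (?e n)\<rbrakk> \<Longrightarrow> connected_component (X - S) x y"
    by metis
  have "\<forall>\<^sub>F i in sequentially. f i ` R \<subseteq> ball q (d n)" for n
    using t d(1)[of n] unfolding tends_def by (metis centre_in_ball open_ball)
  then obtain r0 where r0: "strict_mono r0" "\<And>n. f (r0 n) ` R \<subseteq> ball q (d n)"
    using eventually_choose_subseq[of "\<lambda>n i. f i ` R \<subseteq> ball q (d n)"] by blast
  define V where "V x = connected_component_set (X - R) x" for x
  define big where "big n x \<longleftrightarrow> \<not> f (r0 n) ` V x \<subseteq> ball q (?e n)" for n x
  have VX: "V x \<subseteq> X - R" for x unfolding V_def by (rule connected_component_subset)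
  have homeo: "homeomorphism X X (f i) (f' i)" for i using f by (simp add: homeos_def)
  have fX: "f i x \<in> X" if "x \<in> X" for i x using homeos_image[OF f] that by blast
  have one: "connected_component (X - R) x y" if big: "big n x" "big n y" for n x y
  proof -
    obtain u v where uv: "u \<in> V x" "f (r0 n) u \<notin> ball q (?e n)" "v \<in> V y" "f (r0 n) v \<notin> ball q (?e n)"
      using big unfolding big_def by blast
    have uvX: "u \<in> X - R" "v \<in> X - R" using uv VX by blast+
    have "f (r0 n) ` R \<subseteq> cball q (d n)" using r0(2)[of n] ball_subset_cball by blast
    then have "connected_component (X - f (r0 n) ` R) (f (r0 n) u) (f (r0 n) v)"
      using uv uvX fX by (intro d(2)) auto
    then have "\<not> separates X R u v"
      using separates_homeomorphic[OF homeo R(2), of u v "r0 n"] by (auto simp: separates_def)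
    then have "connected_component (X - R) u v" using uvX by (simp add: separates_def)
    moreover have "connected_component (X - R) x u" "connected_component (X - R) y v"
      using uv by (auto simp: V_def)
    ultimately show ?thesis by (meson connected_component_sym connected_component_trans)
  qed
  have reg: "regular (\<lambda>i. f (r0 (r1 i))) x"
    if r1: "strict_mono r1" and x: "x \<in> X - R" and small: "\<forall>\<^sub>F i in sequentially. \<not> big (r1 i) x" for r1 x
  proof -
    have "tends (\<lambda>i. f (r0 (r1 i))) (V x) q"
      unfolding tends_def
    proof (intro allI impI)
      fix U assume "open U \<and> q \<in> U"
      then obtain e where e: "e > 0" "ball q e \<subseteq> U" using open_contains_ball by metis
      have "\<forall>\<^sub>F n in sequentially. ?e n < e"
        using LIMSEQ_inverse_real_of_nat e(1) order_tendstoD(2) by blast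
      then have "\<forall>\<^sub>F i in sequentially. ?e (r1 i) < e" by (rule eventually_subseq[OF r1])
      with small show "\<forall>\<^sub>F i in sequentially. f (r0 (r1 i)) ` V x \<subseteq> U"
      proof eventually_elim
        case (elim i)
        have "f (r0 (r1 i)) ` V x \<subseteq> ball q (?e (r1 i))" using elim(1) by (simp add: big_def)
        also have "\<dots> \<subseteq> ball q e" using elim(2) by (intro subset_ball) simp
        finally show ?case using e(2) by blast
      qed
    qed
    moreover have "openin (top_of_set X) (V x)" unfolding V_def by (rule openin_component_Diff[OF R(1)])
    moreover have "x \<in> V x" using x by (simp add: V_def)
    ultimately show ?thesis using q unfolding regular_def by blast
  qed
  show ?thesis
  \<comment> \<open>If one component escapes the balls for infinitely many indices, these are kept,
    and every other component is squeezed along them. Otherwise each component escapes only finitely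
    often.\<close>
  proof (cases "\<exists>z. infinite {n. big n z}")
    case True
    then obtain z where inf: "infinite {n. big n z}" by blast
    define r1 where "r1 = enumerate {n. big n z}"
    have r1: "strict_mono r1" "\<And>i. big (r1 i) z"
      using strict_mono_enumerate[OF inf] enumerate_in_set[OF inf] by (auto simp: r1_def)
    have "regular (\<lambda>i. f (r0 (r1 i))) x \<or> regular (\<lambda>i. f (r0 (r1 i))) y" if sep: "separates X R x y" for x y
    proof -
      have xy: "x \<in> X - R" "y \<in> X - R" "\<not> connected_component (X - R) x y"
        using sep by (auto simp: separates_def)
      then have "\<not> connected_component (X - R) z x \<or> \<not> connected_component (X - R) z y"
        by (meson connected_component_sym connected_component_trans)
      then have "(\<forall>i. \<not> big (r1 i) x) \<or> (\<forall>i. \<not> big (r1 i) y)"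
        using one r1(2) by blast
      then show ?thesis using reg[OF r1(1) xy(1)] reg[OF r1(1) xy(2)] by fastforce
    qed
    moreover have "strict_mono (\<lambda>i. r0 (r1 i))"
      using r0(1) r1(1) by (simp add: strict_mono_def)
    ultimately show ?thesis using that by blast
  next
    case False
    have "regular (\<lambda>i. f (r0 i)) x" if sep: "separates X R x y" for x y
    proof -
      have x: "x \<in> X - R" using sep by (auto simp: separates_def)
      have "finite {n. big n x}" using False by blast
      then have "\<forall>\<^sub>F n in sequentially. \<not> big n x"
        by (simp add: cofinite_eq_sequentially[symmetric] eventually_cofinite)
      then show ?thesis using reg[of id x] x by (simp add: strict_mono_def)
    qed
    then show ?thesis using that r0(1) by blast
  qed
qed

lemma focusing_subsequence:
  assumes f: "homeos f f'" "dichotomy f"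
  obtains r where "strict_mono r" "focusing (\<lambda>i. f (r i))"
proof -
  \<comment> \<open>The premise speaks of the full sequence \<open>f\<close>, not of
    \<open>h\<close>, so that it cannot become true on passing to a subsequence. At the end
    \<open>tends_of_subseq\<close> leads from the selected subsequence back to
    \<open>f\<close>.\<close>
  define Q where "Q \<B> h \<longleftrightarrow> ((\<exists>q\<in>X. tends f (\<Union>\<B>) q) \<longrightarrow>
     (\<forall>x y. separates X (\<Union>\<B>) x y \<longrightarrow> regular h x \<or> regular h y))" for \<B> h
  have tail: "regular h x" if reg: "regular (\<lambda>i. h (i + m)) x" for h m x
  proof -
    obtain N q where "openin (top_of_set X) N" "x \<in> N" "q \<in> X" "tends (\<lambda>i. h (i + m)) N q"
      using reg unfolding regular_def by blast
    then show ?thesis using tends_tail unfolding regular_def by blast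
  qed
  obtain r where r: "strict_mono r" "\<And>\<B>. \<B> \<in> {\<B>. finite \<B> \<and> \<B> \<subseteq> \<A>} \<Longrightarrow> Q \<B> (\<lambda>i. f (r i))"
  proof (rule diagonal_subsequence[of "{\<B>. finite \<B> \<and> \<B> \<subseteq> \<A>}" Q f])
    show "countable {\<B>. finite \<B> \<and> \<B> \<subseteq> \<A>}"
      using countable_members by (rule countable_Collect_finite_subset)
    fix \<B> and s :: "nat \<Rightarrow> nat" assume B: "\<B> \<in> {\<B>. finite \<B> \<and> \<B> \<subseteq> \<A>}" and s: "strict_mono s"
    show "\<exists>r. strict_mono r \<and> Q \<B> (\<lambda>i. f (s (r i)))"
    proof (cases "\<exists>q\<in>X. tends f (\<Union>\<B>) q")
      case True
      then obtain q where q: "q \<in> X" "tends f (\<Union>\<B>) q" by blast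
      have h: "homeos (\<lambda>i. f (s i)) (\<lambda>i. f' (s i))" using f(1) by (simp add: homeos_def)
      obtain r where "strict_mono r"
        "\<And>x y. separates X (\<Union>\<B>) x y \<Longrightarrow> regular (\<lambda>i. f (s (r i))) x \<or> regular (\<lambda>i. f (s (r i))) y"
        using focusing_subsequence_single[OF h _ _ q(1) tends_subseq[OF q(2) s]]
          closed_Union_members Union_members_subset B by blast
      then show ?thesis unfolding Q_def by blast
    next
      case False
      then show ?thesis by (intro exI[of _ id]) (simp add: Q_def strict_mono_def)
    qed
  next
    show "Q \<B> h \<Longrightarrow> Q \<B> (\<lambda>i. h (r i))" if "strict_mono r" for \<B> h and r :: "nat \<Rightarrow> nat"
      using regular_subseq that unfolding Q_def by blast
    show "Q \<B> (\<lambda>i. h (i + m)) \<Longrightarrow> Q \<B> h" for \<B> h m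
      using tail unfolding Q_def by blast
  qed blast
  have "focusing (\<lambda>i. f (r i))"
    unfolding focusing_def
  proof (intro allI impI, elim conjE)
    fix \<B> q x y
    assume B: "finite \<B>" "\<B> \<subseteq> \<A>" "q \<in> X" "tends (\<lambda>i. f (r i)) (\<Union>\<B>) q" "separates X (\<Union>\<B>) x y"
    have "tends f B q" if "B \<in> \<B>" for B
      using tends_of_subseq[OF f r(1)] tends_mono[OF B(4)] B(2) that by blast
    then have "tends f (\<Union>\<B>) q" by (rule tends_Union[OF B(1)])
    then show "regular (\<lambda>i. f (r i)) x \<or> regular (\<lambda>i. f (r i)) y"
      using r(2)[of \<B>] B unfolding Q_def by blast
  qed
  then show ?thesis using that r(1) by blast
qed

end

lemma group_action_homeomorphism:
  assumes act: "group_action G X phi" and cont: "\<forall>g\<in>carrier G. continuous_on X (phi g)"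
    and g: "g \<in> carrier G"
  shows "homeomorphism X X (phi g) (phi (inv\<^bsub>G\<^esub> g))"
proof -
  interpret group_action G X phi by (rule act)
  interpret G: group G using group_hom group_hom.axioms(1) by auto
  have ig: "inv\<^bsub>G\<^esub> g \<in> carrier G" using g by simp
  have "phi (inv\<^bsub>G\<^esub> g) (phi g x) = x" "phi g (phi (inv\<^bsub>G\<^esub> g) x) = x" if "x \<in> X" for x
    using orbit_sym_aux[OF g that refl] orbit_sym_aux[OF ig that refl] g by auto
  then show ?thesis
    using cont g ig surj_prop by (intro homeomorphismI) auto
qed

context fine_family
begin

text \<open>If one image \<open>A'\<close> recurs infinitely often, the group elements concerned
  differ from a fixed one by elements of the stabilizer, whose convergence property applies.
  Otherwise each image occurs finitely often, so by nullity the diameters tend to 0, and compactness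
  of \<open>X\<close> supplies the limit point.\<close>

lemma dichotomy_subsequence_single:
  fixes G :: "('g, 'b) monoid_scheme"
  assumes act: "group_action G X phi" and cont: "\<forall>g\<in>carrier G. continuous_on X (phi g)"
    and A_inv: "\<And>g A. g \<in> carrier G \<Longrightarrow> A \<in> \<A> \<Longrightarrow> phi g ` A \<in> \<A>"
    and stab: "convergence_group phi (stabilizer_set G phi A) A"
    and A: "A \<in> \<A>" and k: "inj k" "range k \<subseteq> carrier G"
  obtains r :: "nat \<Rightarrow> nat" where "strict_mono r"
    "(\<exists>q\<in>X. tends (\<lambda>i. phi (k (r i))) A q) \<or> (\<exists>A' n p. moves (\<lambda>i. phi (k (r i))) A A' n p)"
proof -
  interpret group_action G X phi by (rule act)
  interpret G: group G using group_hom group_hom.axioms(1) by auto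
  have kG: "k i \<in> carrier G" for i using k(2) by blast
  have AX: "A \<subseteq> X" using member_subset[OF A] .
  note homeo = group_action_homeomorphism[OF act cont]
  show ?thesis
  proof (cases "\<exists>A'. infinite {i. phi (k i) ` A = A'}")
    case True
    then obtain A' where inf: "infinite {i. phi (k i) ` A = A'}" by blast
    define r where "r = enumerate {i. phi (k i) ` A = A'}"
    have r: "strict_mono r" "\<And>i. phi (k (r i)) ` A = A'"
      using strict_mono_enumerate[OF inf] enumerate_in_set[OF inf] by (auto simp: r_def)
    define k0 where "k0 = k (r 0)"
    have k0: "k0 \<in> carrier G" "phi k0 ` A = A'" using kG r(2) by (auto simp: k0_def)
    define t where "t i = inv\<^bsub>G\<^esub> k0 \<otimes>\<^bsub>G\<^esub> k (r i)" for i
    have tG: "t i \<in> carrier G" for i using kG k0 by (simp add: t_def)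
    have kt: "k (r i) = k0 \<otimes>\<^bsub>G\<^esub> t i" for i
      using kG k0 by (simp add: t_def G.m_assoc[symmetric])
    have "inj t"
    proof (rule injI)
      fix i j assume "t i = t j"
      then have "k (r i) = k (r j)" using kt by simp
      then show "i = j" using k(1) r(1) by (metis injD strict_mono_eq)
    qed
    moreover have tA: "phi (t i) ` A = A" for i
    proof -
      have "phi (t i) ` A = phi (inv\<^bsub>G\<^esub> k0) ` phi (k (r i)) ` A"
        unfolding image_image t_def using AX kG k0
        by (intro image_cong refl composition_rule) auto
      also have "\<dots> = phi (inv\<^bsub>G\<^esub> k0) ` phi k0 ` A" using r(2) k0 by simp
      also have "\<dots> = (\<lambda>x. x) ` A"
        unfolding image_image using homeo[OF k0(1)] AX
        by (intro image_cong refl) (auto simp: homeomorphism_def)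
      finally show ?thesis by simp
    qed
    moreover have "range t \<subseteq> stabilizer_set G phi A" using tG tA by (auto simp: stabilizer_set_def)
    ultimately obtain s where s: "strict_mono s" "convergence_sequence phi A (t \<circ> s)"
      using stab unfolding convergence_group_def by blast
    then obtain n p where np: "n \<in> A" "p \<in> A" and conv:
      "\<And>C U. \<lbrakk>compact C; C \<subseteq> A; n \<notin> C; openin (top_of_set A) U; p \<in> U\<rbrakk> \<Longrightarrow>
         \<forall>\<^sub>F i in sequentially. phi (t (s i)) ` C \<subseteq> U"
      unfolding convergence_sequence_def by auto
    have compA: "compact A" using closed_member[OF A] AX compact_X by (metis compact_Int_closed inf.absorb_iff2)
    have "\<forall>\<^sub>F i in sequentially. phi (t (s i)) ` (A - V) \<subseteq> U"
      if UV: "open U" "p \<in> U" "open V" "n \<in> V" for U V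
    proof -
      have "\<forall>\<^sub>F i in sequentially. phi (t (s i)) ` (A - V) \<subseteq> A \<inter> U"
        using compA UV np by (intro conv compact_diff) auto
      then show ?thesis by (rule eventually_mono) auto
    qed
    then have "moves (\<lambda>i. phi (t (s i))) A A n p"
      using np tA unfolding moves_def by auto
    moreover have "phi (t i) ` X \<subseteq> X" for i using surj_prop[OF tG] by blast
    moreover have "continuous_on X (phi k0)" using cont k0 by blast
    ultimately have "moves (\<lambda>i. phi k0 \<circ> phi (t (s i))) A (phi k0 ` A) n (phi k0 p)"
      using AX by (intro moves_post[where X=X]) auto
    moreover have "(phi k0 \<circ> phi (t (s i))) x = phi (k (r (s i))) x" if "x \<in> A" for i x
      using composition_rule[OF _ k0(1) tG[of "s i"], of x] kt[of "s i"] that AX by auto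
    ultimately have "moves (\<lambda>i. phi (k (r (s i)))) A (phi k0 ` A) n (phi k0 p)"
      using moves_cong[of A "\<lambda>i. phi k0 \<circ> phi (t (s i))" "\<lambda>i. phi (k (r (s i)))"] by blast
    moreover have "strict_mono (\<lambda>i. r (s i))" using r(1) s(1) by (simp add: strict_mono_def)
    ultimately show ?thesis using that by blast
  next
    case False
    obtain a where a: "a \<in> A" using infinite_member[OF A] by fastforce
    have "\<forall>i. phi (k i) a \<in> X" using a AX surj_prop[OF kG] by blast
    then obtain q r where qr: "q \<in> X" "strict_mono r" "((\<lambda>i. phi (k i) a) \<circ> r) \<longlonglongrightarrow> q"
      using compact_X unfolding compact_def by metis
    have small: "\<forall>\<^sub>F i in sequentially. diameter (phi (k i) ` A) \<le> e" if "e > 0" for e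
    proof -
      have "{i. \<not> diameter (phi (k i) ` A) \<le> e} \<subseteq>
          (\<Union>A'\<in>{A' \<in> \<A>. diameter A' > e}. {i. phi (k i) ` A = A'})"
        using A_inv[OF kG A] by auto
      moreover have "finite (\<Union>A'\<in>{A' \<in> \<A>. diameter A' > e}. {i. phi (k i) ` A = A'})"
        using null[OF that] False by auto
      ultimately have "finite {i. \<not> diameter (phi (k i) ` A) \<le> e}" by (rule finite_subset)
      then show ?thesis by (simp add: cofinite_eq_sequentially[symmetric] eventually_cofinite)
    qed
    have "tends (\<lambda>i. phi (k (r i))) A q"
      unfolding tends_def
    proof (intro allI impI)
      fix U assume "open U \<and> q \<in> U"
      then obtain e where e: "e > 0" "ball q e \<subseteq> U" using open_contains_ball by metis
      have "\<forall>\<^sub>F i in sequentially. dist (phi (k (r i)) a) q < e / 2"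
        using qr(3) e(1) by (auto simp: o_def dest: tendstoD[where e="e/2"])
      moreover have "\<forall>\<^sub>F i in sequentially. diameter (phi (k (r i)) ` A) \<le> e / 2"
        using small[of "e / 2"] e(1) eventually_subseq[OF qr(2)] by auto
      ultimately show "\<forall>\<^sub>F i in sequentially. phi (k (r i)) ` A \<subseteq> U"
      proof eventually_elim
        case (elim i)
        have "phi (k (r i)) ` A \<subseteq> X" using surj_prop[OF kG] AX by blast
        then have bd: "bounded (phi (k (r i)) ` A)"
          using compact_X by (meson bounded_subset compact_imp_bounded)
        show ?case
        proof clarify
          fix x assume x: "x \<in> A"
          have "dist (phi (k (r i)) a) (phi (k (r i)) x) \<le> e / 2"
            using diameter_bounded_bound[OF bd, of "phi (k (r i)) a" "phi (k (r i)) x"] a x elim(2) by force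
          then have "dist q (phi (k (r i)) x) < e"
            using elim(1) dist_triangle[of q "phi (k (r i)) x" "phi (k (r i)) a"] by (simp add: dist_commute)
          then show "phi (k (r i)) x \<in> U" using e(2) by auto
        qed
      qed
    qed
    then show ?thesis using that qr by blast
  qed
qed

lemma dichotomy_subsequence:
  fixes G :: "('g, 'b) monoid_scheme"
  assumes act: "group_action G X phi" and cont: "\<forall>g\<in>carrier G. continuous_on X (phi g)"
    and A_inv: "\<And>g A. g \<in> carrier G \<Longrightarrow> A \<in> \<A> \<Longrightarrow> phi g ` A \<in> \<A>"
    and stab: "\<And>A. A \<in> \<A> \<Longrightarrow> convergence_group phi (stabilizer_set G phi A) A"
    and k: "inj k" "range k \<subseteq> carrier G"
  obtains r :: "nat \<Rightarrow> nat" where "strict_mono r" "dichotomy (\<lambda>i. phi (k (r i)))"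
proof -
  define Q where "Q A h \<longleftrightarrow> (\<exists>q\<in>X. tends h A q) \<or> (\<exists>A' n p. moves h A A' n p)"
    for A and h :: "nat \<Rightarrow> 'a \<Rightarrow> 'a"
  obtain r where "strict_mono r" "\<And>A. A \<in> \<A> \<Longrightarrow> Q A (\<lambda>i. phi (k (r i)))"
  proof (rule diagonal_subsequence[of \<A> Q "\<lambda>i. phi (k i)"])
    fix A and s :: "nat \<Rightarrow> nat" assume A: "A \<in> \<A>" and s: "strict_mono s"
    have "inj (\<lambda>i. k (s i))" using inj_compose[OF k(1) strict_mono_imp_inj_on[OF s]] by (simp add: o_def)
    moreover have "range (\<lambda>i. k (s i)) \<subseteq> carrier G" using k(2) by blast
    ultimately obtain r where "strict_mono r" "Q A (\<lambda>i. phi (k (s (r i))))"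
      using dichotomy_subsequence_single[OF act cont A_inv stab[OF A] A] unfolding Q_def by blast
    then show "\<exists>r. strict_mono r \<and> Q A (\<lambda>i. phi (k (s (r i))))" by blast
  next
    show "Q A h \<Longrightarrow> Q A (\<lambda>i. h (r i))" if "strict_mono r" for A h and r :: "nat \<Rightarrow> nat"
      using tends_subseq moves_subseq that unfolding Q_def by blast
    show "Q A (\<lambda>i. h (i + m)) \<Longrightarrow> Q A h" for A h m
      using tends_tail moves_tail unfolding Q_def by blast
  qed (use countable_members in blast)+
  then show ?thesis using that unfolding dichotomy_def Q_def by blast
qed

theorem convergence_group_of_fine_family:
  fixes G :: "('g, 'b) monoid_scheme"
  assumes "X \<noteq> {}"
    and act: "group_action G X phi" and cont: "\<forall>g\<in>carrier G. continuous_on X (phi g)"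
    and A_inv: "\<And>g A. g \<in> carrier G \<Longrightarrow> A \<in> \<A> \<Longrightarrow> phi g ` A \<in> \<A>"
    and stab: "\<And>A. A \<in> \<A> \<Longrightarrow> convergence_group phi (stabilizer_set G phi A) A"
  shows "convergence_group phi (carrier G) X"
  unfolding convergence_group_def
proof (intro allI impI, elim conjE)
  fix g :: "nat \<Rightarrow> 'g" assume g: "inj g" "range g \<subseteq> carrier G"
  interpret group_action G X phi by (rule act)
  interpret G: group G using group_hom group_hom.axioms(1) by auto
  have gG: "g i \<in> carrier G" for i using g(2) by blast
  have hom: "homeos (\<lambda>i. phi (g (r i))) (\<lambda>i. phi (inv\<^bsub>G\<^esub> g (r i)))"
    "homeos (\<lambda>i. phi (inv\<^bsub>G\<^esub> g (r i))) (\<lambda>i. phi (g (r i)))" for r :: "nat \<Rightarrow> nat"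
    unfolding homeos_def using gG A_inv group_action_homeomorphism[OF act cont]
    by (auto intro: homeomorphism_symD)
  \<comment> \<open>Both dichotomies are arranged before either focusing:
    \<open>focusing_subsequence\<close> assumes the dichotomy, and \<open>focusing_subseq\<close>
    needs it to carry focusing through later selections.\<close>
  obtain r1 where r1: "strict_mono r1" "dichotomy (\<lambda>i. phi (g (r1 i)))"
    by (rule dichotomy_subsequence[OF act cont A_inv stab g])
  have "inj (\<lambda>i. inv\<^bsub>G\<^esub> g (r1 i))"
    using g(1) gG r1(1) by (simp add: inj_def strict_mono_eq) (metis G.inv_inv strict_mono_eq)
  moreover have "range (\<lambda>i. inv\<^bsub>G\<^esub> g (r1 i)) \<subseteq> carrier G" using gG by auto
  ultimately obtain r2 where r2: "strict_mono r2" "dichotomy (\<lambda>i. phi (inv\<^bsub>G\<^esub> g (r1 (r2 i))))"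
    using dichotomy_subsequence[OF act cont A_inv stab] by blast
  define s where "s i = r1 (r2 i)" for i
  have s: "dichotomy (\<lambda>i. phi (g (s i)))" "dichotomy (\<lambda>i. phi (inv\<^bsub>G\<^esub> g (s i)))" "strict_mono s"
    using dichotomy_subseq[OF r1(2) r2(1)] r2 r1(1) by (auto simp: s_def strict_mono_def)
  obtain r3 where r3: "strict_mono r3" "focusing (\<lambda>i. phi (g (s (r3 i))))"
    by (rule focusing_subsequence[OF hom(1) s(1)])
  have d: "dichotomy (\<lambda>i. phi (g (s (r3 i))))" "dichotomy (\<lambda>i. phi (inv\<^bsub>G\<^esub> g (s (r3 i))))"
    using dichotomy_subseq[OF s(1) r3(1)] dichotomy_subseq[OF s(2) r3(1)] by auto
  have hom3: "homeos (\<lambda>i. phi (inv\<^bsub>G\<^esub> g (s (r3 i)))) (\<lambda>i. phi (g (s (r3 i))))"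
    "homeos (\<lambda>i. phi (g (s (r3 i)))) (\<lambda>i. phi (inv\<^bsub>G\<^esub> g (s (r3 i))))"
    using hom[of "\<lambda>i. s (r3 i)"] by auto
  obtain r4 where r4: "strict_mono r4" "focusing (\<lambda>i. phi (inv\<^bsub>G\<^esub> g (s (r3 (r4 i)))))"
    by (rule focusing_subsequence[OF hom3(1) d(2)])
  define r where "r i = s (r3 (r4 i))" for i
  interpret good_sequence X \<A> "\<lambda>i. phi (g (r i))" "\<lambda>i. phi (inv\<^bsub>G\<^esub> g (r i))"
  proof unfold_locales
    show "focusing (\<lambda>i. phi (g (r i)))"
      using focusing_subseq[OF hom3(2) d(1) r4(1) r3(2)] by (simp add: r_def)
    show "dichotomy (\<lambda>i. phi (g (r i)))" "dichotomy (\<lambda>i. phi (inv\<^bsub>G\<^esub> g (r i)))"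
      using dichotomy_subseq[OF d(1) r4(1)] dichotomy_subseq[OF d(2) r4(1)] by (auto simp: r_def)
    show "focusing (\<lambda>i. phi (inv\<^bsub>G\<^esub> g (r i)))" using r4(2) by (simp add: r_def)
  qed (rule hom(1))
  obtain n p where np: "n \<in> X" "p \<in> X"
    "\<And>C. compact C \<Longrightarrow> C \<subseteq> X \<Longrightarrow> n \<notin> C \<Longrightarrow> tends (\<lambda>i. phi (g (r i))) C p"
    using converges[OF assms(1)] by blast
  have "convergence_sequence phi X (g \<circ> r)"
    unfolding convergence_sequence_def
  proof (rule bexI[OF _ np(1)], rule bexI[OF _ np(2)], intro allI impI, elim conjE)
    fix C U assume C: "compact C" "C \<subseteq> X" "n \<notin> C" and U: "openin (top_of_set X) U" "p \<in> U"
    obtain T where T: "open T" "U = X \<inter> T" using U(1) by (auto simp: openin_open)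
    have "\<forall>\<^sub>F i in sequentially. phi (g (r i)) ` C \<subseteq> T"
      using np(3)[OF C] T U(2) unfolding tends_def by auto
    then show "\<forall>\<^sub>F i in sequentially. phi ((g \<circ> r) i) ` C \<subseteq> U"
    proof (rule eventually_mono)
      fix i assume i: "phi (g (r i)) ` C \<subseteq> T"
      have "phi (g (r i)) ` C \<subseteq> X" using surj_prop[OF gG] C(2) by blast
      then show "phi ((g \<circ> r) i) ` C \<subseteq> U" using i T by auto
    qed
  qed
  moreover have "strict_mono r" using s(3) r3(1) r4(1) by (simp add: r_def strict_mono_def)
  ultimately show "\<exists>r. strict_mono r \<and> convergence_sequence phi X (g \<circ> r)" by blast
qed

end

theorem mainTheorem1:
  fixes X :: "'a::metric_space set"
    and G :: "('g, 'b) monoid_scheme"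
    and phi :: "'g \<Rightarrow> 'a \<Rightarrow> 'a"
    and \<A> :: "'a set set"
  assumes peano: "peano_continuum X"
    and no_cut: "\<forall>x\<in>X. \<not> cut_point X x"
    and no_ess: "\<forall>f. \<not> essential_circle_map X f"
    and action: "group_action G X phi"
    and homeo: "\<forall>g\<in>carrier G. continuous_on X (phi g)"
    and A_sub: "\<forall>A\<in>\<A>. A \<subseteq> X \<and> connected A \<and> closed A"
    and A_inv: "\<forall>g\<in>carrier G. \<forall>A\<in>\<A>. phi g ` A \<in> \<A>"
    and null: "\<forall>\<epsilon>>0. finite {A\<in>\<A>. diameter A > \<epsilon>}"
    and fine: "\<forall>x\<in>X. \<forall>y\<in>X. x \<noteq> y \<longrightarrow>
                 (\<exists>\<B>. finite \<B> \<and> \<B> \<subseteq> \<A> \<and> separates X (\<Union>\<B>) x y)"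
    and stab: "\<forall>A\<in>\<A>. convergence_group phi (stabilizer_set G phi A) A"
  shows "convergence_group phi (carrier G) X"
proof -
  interpret simple_peano X
    using peano no_cut no_ess by unfold_locales (auto simp: peano_continuum_def cut_point_def)
  \<comment> \<open>Dropping the degenerate members keeps the family fine by
    \<open>separates_connected_subfamily\<close>, and keeps it invariant because group elements act
    injectively.\<close>
  interpret fine_family X "{A\<in>\<A>. infinite A}"
  proof unfold_locales
    show "finite {A \<in> {A \<in> \<A>. infinite A}. e < diameter A}" if "e > 0" for e
      using null that by (auto intro: finite_subset[of _ "{A\<in>\<A>. diameter A > e}"])
    show "\<exists>\<B>. finite \<B> \<and> \<B> \<subseteq> {A \<in> \<A>. infinite A} \<and> connected (\<Union>\<B>) \<and> separates X (\<Union>\<B>) x y"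
      if xy: "x \<in> X" "y \<in> X" "x \<noteq> y" for x y
    proof -
      obtain \<B> where B: "finite \<B>" "\<B> \<subseteq> \<A>" "separates X (\<Union>\<B>) x y" using fine xy by blast
      have mem: "closed B \<and> connected B \<and> B \<subseteq> X" if "B \<in> \<B>" for B using A_sub B(2) that by blast
      obtain \<C> where C: "\<C> \<subseteq> \<B>" "connected (\<Union>\<C>)" "separates X (\<Union>\<C>) x y" "\<And>B. B \<in> \<C> \<Longrightarrow> infinite B"
        using separates_connected_subfamily[OF B(1) mem B(3)] by blast
      then have "finite \<C>" "\<C> \<subseteq> {A \<in> \<A>. infinite A}" using B finite_subset by auto
      then show ?thesis using C by blast
    qed
  qed (use A_sub in auto)
  interpret group_action G X phi by (rule action)
  show ?thesis
  proof (rule convergence_group_of_fine_family[OF _ action homeo])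
    show "X \<noteq> {}" using peano by (simp add: peano_continuum_def)
    show "phi g ` A \<in> {A \<in> \<A>. infinite A}" if "g \<in> carrier G" "A \<in> {A \<in> \<A>. infinite A}" for g A
    proof -
      have "inj_on (phi g) A" using inj_prop[OF that(1)] A_sub that(2) by (auto intro: inj_on_subset)
      then show ?thesis using that A_inv by (auto dest: finite_imageD)
    qed
    show "convergence_group phi (stabilizer_set G phi A) A" if "A \<in> {A \<in> \<A>. infinite A}" for A
      using stab that by blast
  qed
qed

end
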